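(* Let $Q$ be a cluster quiver of mutation-Dynkin type with connected components $Q_1,\dots,Q_r$ of mutation-Dynkin types $A_{n_1},\dots,A_{n_r}$ respectively, for some $n_1,\dots,n_r\in\mathbb{Z}^+$. Let $G_Q$ be the cluster group of $Q$ with its set of defining generators $T$, let $\mathcal{I}$ be the power set of $T$ (a lattice under inclusion), let $\mathcal{G}$ be the lattice of all subgroups of $G_Q$ under inclusion, and let $\tilde{\mathcal{G}}=\{G_I : I\in\mathcal{I}\}$ be the set of parabolic subgroups of $G_Q$. Then $\tilde{\mathcal{G}}$ is a sublattice of $\mathcal{G}$ and the map $$\Phi:\mathcal{I}\longrightarrow\tilde{\mathcal{G}},\qquad \Phi(I)=G_I,$$ is a lattice isomorphism.
   Context: A cluster quiver is a finite quiver (directed multigraph) with no loops and no oriented 2-cycles; its set of vertices is denoted $Q_0$. The mutation $\mu_v(Q)$ of a cluster quiver $Q$ at a vertex $v$ is obtained by: (a) for each path $u\to v\to w$ adding an arrow $u\to w$ (counted with multiplicity: $x$ arrows $u\to v$ and $y$ arrows $v\to w$ give $xy$ new arrows); (b) reversing each arrow incident to $v$; (c) repeatedly deleting pairs of arrows forming 2-cycles until none remain. Two cluster quivers are mutation-equivalent if a finite sequence of mutations transforms one into the other. A cluster quiver is of mutation-Dynkin type $A_n$ if it is mutation-equivalent to an orientation of the Dynkin diagram $A_n$ (a path on $n$ vertices). An arrow of $Q$ joining $i$ and $j$ is simple if it is the only arrow between $i$ and $j$. The cluster group $G_Q$ is the group with presentation $\langle T\mid R\rangle$, where $T=\{t_i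 : i\in Q_0\}$ and $R$ consists of: (a) $t_i^2=e$ for all $i\in Q_0$; (b)(i) $t_it_j=t_jt_i$ if there is no arrow between $i$ and $j$; (b)(ii) $t_it_jt_i=t_jt_it_j$ if $i$ and $j$ are joined by a simple arrow; (c) for every chordless oriented cycle $i_1\to i_2\to\cdots\to i_m\to i_1$ in $Q$ all of whose arrows are simple, the relations stating that the $m$ words $t_{i_a}t_{i_{a+1}}\cdots t_{i_{a+2m-3}}$ ($a=1,\dots,m$, subscripts of $i$ taken modulo $m$), each of length $2m-2$, are all equal. For $I\subseteq T$, $G_I$ is the subgroup of $G_Q$ generated by $I$; subgroups of this form are called parabolic subgroups. In $\mathcal{G}$, the join of $H_1,H_2$ is $\langle H_1\cup H_2\rangle$ and the meet is $H_1\cap H_2$. A sublattice of a lattice is a non-empty subset closed under join and meet; a lattice isomorphism is a bijection preserving joins and meets. *)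

theory Defs
  imports "HOL-Algebra.Generated_Groups" "HOL-Algebra.Lattice"
begin

section \<open>Cluster quivers and mutation\<close>

text \<open>\<open>arr Q i j\<close> is the number of arrows from \<open>i\<close> to \<open>j\<close>.\<close>

record 'v quiver =
  verts :: "'v set"
  arr :: "'v \<Rightarrow> 'v \<Rightarrow> nat"

definition cluster_quiver :: "'v quiver \<Rightarrow> bool" where
  "cluster_quiver Q \<longleftrightarrow>
     finite (verts Q) \<and>
     (\<forall>i j. arr Q i j > 0 \<longrightarrow> i \<in> verts Q \<and> j \<in> verts Q) \<and>
     (\<forall>i. arr Q i i = 0) \<and>
     (\<forall>i j. \<not> (arr Q i j > 0 \<and> arr Q j i > 0))"

definition add_paths :: "'v \<Rightarrow> ('v \<Rightarrow> 'v \<Rightarrow> nat) \<Rightarrow> 'v \<Rightarrow> 'v \<Rightarrow> nat" where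
  "add_paths v a = (\<lambda>u w. a u w + a u v * a v w)"

definition reverse_at :: "'v \<Rightarrow> ('v \<Rightarrow> 'v \<Rightarrow> nat) \<Rightarrow> 'v \<Rightarrow> 'v \<Rightarrow> nat" where
  "reverse_at v a = (\<lambda>u w. if u = v \<or> w = v then a w u else a u w)"

text \<open>Removing 2-cycles between \<open>u\<close> and \<open>w\<close> as long as possible removes
  \<open>min (a u w) (a w u)\<close> arrows in each direction; subtraction on naturals truncates.\<close>

definition cancel_two_cycles :: "('v \<Rightarrow> 'v \<Rightarrow> nat) \<Rightarrow> 'v \<Rightarrow> 'v \<Rightarrow> nat" where
  "cancel_two_cycles a = (\<lambda>u w. a u w - a w u)"

definition mutate :: "'v \<Rightarrow> 'v quiver \<Rightarrow> 'v quiver" where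
  "mutate v Q =
     \<lparr>verts = verts Q, arr = cancel_two_cycles (reverse_at v (add_paths v (arr Q)))\<rparr>"

definition mutation_equivalent :: "'v quiver \<Rightarrow> 'v quiver \<Rightarrow> bool" where
  "mutation_equivalent = (\<lambda>Q Q'. \<exists>v \<in> verts Q. Q' = mutate v Q)\<^sup>*\<^sup>*"

definition orientation_of_A :: "nat \<Rightarrow> 'v quiver \<Rightarrow> bool" where
  "orientation_of_A n D \<longleftrightarrow>
     cluster_quiver D \<and>
     (\<exists>f. bij_betw f {1..n} (verts D) \<and>
          (\<forall>a \<in> {1..n}. \<forall>b \<in> {1..n}.
             arr D (f a) (f b) + arr D (f b) (f a) = (if a = b + 1 \<or> b = a + 1 then 1 else 0)))"

text \<open>Mutation does not change the vertex set, so the isomorphism of \<open>D\<close> with an oriented path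
  is the labelling \<open>f\<close> in \<^const>\<open>orientation_of_A\<close>, and nothing else is
  needed to make the type independent of the names of the vertices.\<close>

definition mutation_type_A :: "nat \<Rightarrow> 'v quiver \<Rightarrow> bool" where
  "mutation_type_A n Q \<longleftrightarrow>
     cluster_quiver Q \<and> (\<exists>D. orientation_of_A n D \<and> mutation_equivalent Q D)"

definition full_subquiver :: "'v quiver \<Rightarrow> 'v set \<Rightarrow> 'v quiver" where
  "full_subquiver Q C = \<lparr>verts = C, arr = (\<lambda>i j. if i \<in> C \<and> j \<in> C then arr Q i j else 0)\<rparr>"

definition connected_components :: "'v quiver \<Rightarrow> 'v quiver set" where
  "connected_components Q =
     full_subquiver Q `
       (verts Q // {(i, j). i \<in> verts Q \<and> j \<in> verts Q \<and> equivclp (\<lambda>x y. arr Q x y > 0) i j})"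


section \<open>Groups given by generators and relations\<close>

text \<open>A letter \<open>(g, True)\<close> stands for the generator \<open>g\<close> and \<open>(g, False)\<close> for its formal inverse;
  a relation \<open>l = r\<close> is the pair \<open>(l, r)\<close>.\<close>

type_synonym 'g word = "('g \<times> bool) list"

abbreviation words :: "'g set \<Rightarrow> 'g word set" where
  "words S \<equiv> lists (S \<times> UNIV)"

inductive pres_eq :: "'g set \<Rightarrow> ('g word \<times> 'g word) set \<Rightarrow> 'g word \<Rightarrow> 'g word \<Rightarrow> bool"
  for S :: "'g set" and R :: "('g word \<times> 'g word) set" where
  refl: "w \<in> words S \<Longrightarrow> pres_eq S R w w"
| sym: "pres_eq S R u w \<Longrightarrow> pres_eq S R w u"
| trans: "pres_eq S R u v \<Longrightarrow> pres_eq S R v w \<Longrightarrow> pres_eq S R u w"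
| cancel: "u \<in> words S \<Longrightarrow> w \<in> words S \<Longrightarrow> g \<in> S \<Longrightarrow>
           pres_eq S R (u @ [(g, b), (g, \<not> b)] @ w) (u @ w)"
| rel: "u \<in> words S \<Longrightarrow> w \<in> words S \<Longrightarrow> (l, r) \<in> R \<Longrightarrow> l \<in> words S \<Longrightarrow> r \<in> words S \<Longrightarrow>
        pres_eq S R (u @ l @ w) (u @ r @ w)"

definition word_class :: "'g set \<Rightarrow> ('g word \<times> 'g word) set \<Rightarrow> 'g word \<Rightarrow> 'g word set" where
  "word_class S R w = {w'. pres_eq S R w w'}"

definition presented_group :: "'g set \<Rightarrow> ('g word \<times> 'g word) set \<Rightarrow> 'g word set monoid" where
  "presented_group S R =
     \<lparr>carrier = word_class S R ` words S,
      monoid.mult = (\<lambda>A B. \<Union>u \<in> A. \<Union>w \<in> B. word_class S R (u @ w)),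
      one = word_class S R []\<rparr>"

lemma pres_eq_words: "pres_eq S R u w \<Longrightarrow> u \<in> words S \<and> w \<in> words S"
  by (induction rule: pres_eq.induct) auto

lemma pres_eq_append_left:
  assumes "pres_eq S R u w" "x \<in> words S"
  shows "pres_eq S R (x @ u) (x @ w)"
  using assms
proof (induction rule: pres_eq.induct)
  case (cancel u w g b)
  then show ?case using pres_eq.cancel[of "x @ u" S w g R b] by simp
next
  case (rel u w l r)
  then show ?case using pres_eq.rel[of "x @ u" S w l r R] by simp
qed (simp_all add: pres_eq.refl pres_eq.sym, metis pres_eq.trans)

lemma pres_eq_append_right:
  assumes "pres_eq S R u w" "x \<in> words S"
  shows "pres_eq S R (u @ x) (w @ x)"
  using assms
proof (induction rule: pres_eq.induct)
  case (cancel u w g b)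
  then show ?case using pres_eq.cancel[of u S "w @ x" g R b] by simp
next
  case (rel u w l r)
  then show ?case using pres_eq.rel[of u S "w @ x" l r R] by simp
qed (simp_all add: pres_eq.refl pres_eq.sym, metis pres_eq.trans)

lemma pres_eq_append:
  assumes "pres_eq S R u u'" "pres_eq S R w w'"
  shows "pres_eq S R (u @ w) (u' @ w')"
proof (rule pres_eq.trans)
  show "pres_eq S R (u @ w) (u' @ w)"
    using assms pres_eq_words[of S R w w'] by (intro pres_eq_append_right) simp_all
  show "pres_eq S R (u' @ w) (u' @ w')"
    using assms pres_eq_words[of S R u u'] by (intro pres_eq_append_left) simp_all
qed

lemma word_class_eq_iff:
  assumes "u \<in> words S"
  shows "word_class S R u = word_class S R w \<longleftrightarrow> pres_eq S R u w"
proof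
  assume "word_class S R u = word_class S R w"
  moreover have "u \<in> word_class S R u"
    using assms by (simp add: word_class_def pres_eq.refl)
  ultimately show "pres_eq S R u w"
    by (simp add: word_class_def pres_eq.sym)
next
  assume uw: "pres_eq S R u w"
  have "pres_eq S R u x \<longleftrightarrow> pres_eq S R w x" for x
    using uw pres_eq.sym pres_eq.trans by metis
  then show "word_class S R u = word_class S R w"
    by (simp add: word_class_def)
qed

lemma presented_group_mult:
  assumes "u \<in> words S" "w \<in> words S"
  shows "word_class S R u \<otimes>\<^bsub>presented_group S R\<^esub> word_class S R w = word_class S R (u @ w)"
proof -
  have eq: "word_class S R (u' @ w') = word_class S R (u @ w)"
    if "u' \<in> word_class S R u" "w' \<in> word_class S R w" for u' w'
  proof -
    have "pres_eq S R (u @ w) (u' @ w')"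
      using that by (simp add: word_class_def pres_eq_append)
    moreover have "u @ w \<in> words S" using assms by simp
    ultimately show ?thesis using word_class_eq_iff by metis
  qed
  have ne: "word_class S R u \<noteq> {}" "word_class S R w \<noteq> {}"
    using assms by (auto simp: word_class_def intro: pres_eq.refl)
  have "(\<Union>u' \<in> word_class S R u. \<Union>w' \<in> word_class S R w. word_class S R (u' @ w'))
      = word_class S R (u @ w)"
    using ne by (simp add: eq cong: SUP_cong)
  then show ?thesis by (simp add: presented_group_def)
qed

lemma words_inverse: "w \<in> words S \<Longrightarrow> rev (map (apsnd Not) w) \<in> words S"
  by (induction w) auto

lemma pres_eq_inverse:
  assumes "w \<in> words S"
  shows "pres_eq S R (rev (map (apsnd Not) w) @ w) []"
  using assms
proof (induction w rule: list.induct)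
  case Nil
  then show ?case by (simp add: pres_eq.refl)
next
  case (Cons x w)
  obtain g b where x: "x = (g, b)" by fastforce
  have inv: "rev (map (apsnd Not) w) \<in> words S"
    using Cons.prems by (intro words_inverse) simp
  have "pres_eq S R (rev (map (apsnd Not) w) @ [(g, \<not> b), (g, \<not> \<not> b)] @ w)
          (rev (map (apsnd Not) w) @ w)"
    using Cons.prems x inv by (intro pres_eq.cancel) auto
  moreover have "pres_eq S R (rev (map (apsnd Not) w) @ w) []"
    using Cons by simp
  ultimately show ?case using x by (simp add: pres_eq.trans)
qed

theorem group_presented_group: "group (presented_group S R)"
proof (rule groupI)
  let ?G = "presented_group S R"
  have carr: "carrier ?G = word_class S R ` words S" and one: "\<one>\<^bsub>?G\<^esub> = word_class S R []"
    by (simp_all add: presented_group_def)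
  show "\<one>\<^bsub>?G\<^esub> \<in> carrier ?G" by (auto simp: carr one)
  show "x \<otimes>\<^bsub>?G\<^esub> y \<in> carrier ?G" if "x \<in> carrier ?G" "y \<in> carrier ?G" for x y
    using that unfolding carr by (elim imageE) (simp add: presented_group_mult)
  show "x \<otimes>\<^bsub>?G\<^esub> y \<otimes>\<^bsub>?G\<^esub> z = x \<otimes>\<^bsub>?G\<^esub> (y \<otimes>\<^bsub>?G\<^esub> z)"
    if "x \<in> carrier ?G" "y \<in> carrier ?G" "z \<in> carrier ?G" for x y z
    using that unfolding carr by (elim imageE) (simp add: presented_group_mult)
  show "\<one>\<^bsub>?G\<^esub> \<otimes>\<^bsub>?G\<^esub> x = x" if "x \<in> carrier ?G" for x
    using that unfolding carr one by (elim imageE) (simp add: presented_group_mult)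
  show "\<exists>y \<in> carrier ?G. y \<otimes>\<^bsub>?G\<^esub> x = \<one>\<^bsub>?G\<^esub>" if x: "x \<in> carrier ?G" for x
  proof -
    obtain w where w: "w \<in> words S" "x = word_class S R w"
      using x unfolding carr by blast
    let ?w' = "rev (map (apsnd Not) w)"
    have w': "?w' \<in> words S" using w(1) by (rule words_inverse)
    have "?w' @ w \<in> words S" using w(1) w' by (simp only: append_in_lists_conv simp_thms)
    then have "word_class S R (?w' @ w) = word_class S R []"
      using pres_eq_inverse[OF w(1)] by (simp only: word_class_eq_iff)
    then have "word_class S R ?w' \<otimes>\<^bsub>?G\<^esub> x = \<one>\<^bsub>?G\<^esub>"
      by (simp only: w(2) one presented_group_mult[OF w' w(1)])
    then show ?thesis unfolding carr using imageI[OF w'] by (rule bexI)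
  qed
qed


section \<open>Cluster groups\<close>

definition no_arrow :: "'v quiver \<Rightarrow> 'v \<Rightarrow> 'v \<Rightarrow> bool" where
  "no_arrow Q i j \<longleftrightarrow> arr Q i j = 0 \<and> arr Q j i = 0"

definition joined_by_simple_arrow :: "'v quiver \<Rightarrow> 'v \<Rightarrow> 'v \<Rightarrow> bool" where
  "joined_by_simple_arrow Q i j \<longleftrightarrow> arr Q i j + arr Q j i = 1"

text \<open>The list \<open>c = [i\<^sub>1, \<dots>, i\<^sub>m]\<close> represents the oriented cycle \<open>i\<^sub>1 \<rightarrow> \<dots> \<rightarrow> i\<^sub>m \<rightarrow> i\<^sub>1\<close>.
  As there are no loops and no 2-cycles, \<open>m \<ge> 3\<close> excludes nothing.\<close>

definition chordless_oriented_cycle :: "'v quiver \<Rightarrow> 'v list \<Rightarrow> bool" where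
  "chordless_oriented_cycle Q c \<longleftrightarrow>
     (let m = length c in
       3 \<le> m \<and> distinct c \<and> set c \<subseteq> verts Q \<and>
       (\<forall>k < m. arr Q (c ! k) (c ! ((k + 1) mod m)) > 0) \<and>
       (\<forall>k < m. \<forall>l < m. l \<noteq> (k + 1) mod m \<and> k \<noteq> (l + 1) mod m \<longrightarrow> no_arrow Q (c ! k) (c ! l)))"

definition all_arrows_simple :: "'v quiver \<Rightarrow> 'v list \<Rightarrow> bool" where
  "all_arrows_simple Q c \<longleftrightarrow>
     (\<forall>k < length c. joined_by_simple_arrow Q (c ! k) (c ! ((k + 1) mod length c)))"

datatype 'v generator = gen_t 'v

definition cluster_generators :: "'v quiver \<Rightarrow> 'v generator set" where
  "cluster_generators Q = gen_t ` verts Q"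

definition t_word :: "'v list \<Rightarrow> 'v generator word" where
  "t_word is = map (\<lambda>i. (gen_t i, True)) is"

text \<open>The word of length \<open>2m - 2\<close> running round the cycle \<open>c\<close> from position \<open>a\<close>; positions
  are counted from \<open>0\<close>.\<close>

definition cycle_word :: "'v list \<Rightarrow> nat \<Rightarrow> 'v generator word" where
  "cycle_word c a = t_word (map (\<lambda>k. c ! ((a + k) mod length c)) [0..<2 * length c - 2])"

definition cluster_relations :: "'v quiver \<Rightarrow> ('v generator word \<times> 'v generator word) set" where
  "cluster_relations Q =
     {(t_word [i, i], []) | i. i \<in> verts Q} \<union>
     {(t_word [i, j], t_word [j, i]) | i j. i \<in> verts Q \<and> j \<in> verts Q \<and> no_arrow Q i j} \<union>
     {(t_word [i, j, i], t_word [j, i, j]) | i j.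
        i \<in> verts Q \<and> j \<in> verts Q \<and> joined_by_simple_arrow Q i j} \<union>
     {(cycle_word c a, cycle_word c b) | c a b.
        chordless_oriented_cycle Q c \<and> all_arrows_simple Q c \<and> a < length c \<and> b < length c}"

definition cluster_group :: "'v quiver \<Rightarrow> 'v generator word set monoid" where
  "cluster_group Q = presented_group (cluster_generators Q) (cluster_relations Q)"

definition gen_elem :: "'v quiver \<Rightarrow> 'v generator \<Rightarrow> 'v generator word set" where
  "gen_elem Q g = word_class (cluster_generators Q) (cluster_relations Q) [(g, True)]"

text \<open>\<open>I\<close> is a set of generator symbols of the presentation; that distinct symbols give distinct
  elements of the cluster group is not presupposed.\<close>

definition parabolic :: "'v quiver \<Rightarrow> 'v generator set \<Rightarrow> 'v generator word set set" where
  "parabolic Q I = generate (cluster_group Q) (gen_elem Q ` I)"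

definition parabolic_subgroups :: "'v quiver \<Rightarrow> 'v generator word set set set" where
  "parabolic_subgroups Q = {parabolic Q I | I. I \<in> Pow (cluster_generators Q)}"

theorem group_cluster_group: "group (cluster_group Q)"
  unfolding cluster_group_def by (rule group_presented_group)

lemma gen_elem_in_carrier:
  "g \<in> cluster_generators Q \<Longrightarrow> gen_elem Q g \<in> carrier (cluster_group Q)"
  by (auto simp: gen_elem_def cluster_group_def presented_group_def)


section \<open>Lattices\<close>

definition inclusion_order :: "'a set set \<Rightarrow> 'a set gorder" where
  "inclusion_order \<A> = \<lparr>carrier = \<A>, eq = (=), le = (\<subseteq>)\<rparr>"

definition subgroup_lattice :: "('a, 'b) monoid_scheme \<Rightarrow> 'a set gorder" where
  "subgroup_lattice G = inclusion_order {H. subgroup H G}"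

definition sublattice :: "'a set \<Rightarrow> ('a, 'b) gorder_scheme \<Rightarrow> bool" where
  "sublattice M L \<longleftrightarrow>
     lattice L \<and> M \<subseteq> carrier L \<and> M \<noteq> {} \<and>
     (\<forall>x \<in> M. \<forall>y \<in> M. x \<squnion>\<^bsub>L\<^esub> y \<in> M \<and> x \<sqinter>\<^bsub>L\<^esub> y \<in> M)"

text \<open>\<^const>\<open>join_pres\<close> and \<^const>\<open>meet_pres\<close> include that both orders are lattices.\<close>

definition lattice_isomorphism ::
  "('a, 'c) gorder_scheme \<Rightarrow> ('b, 'd) gorder_scheme \<Rightarrow> ('a \<Rightarrow> 'b) \<Rightarrow> bool" where
  "lattice_isomorphism L M f \<longleftrightarrow>
     bij_betw f (carrier L) (carrier M) \<and> join_pres L M f \<and> meet_pres L M f"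

theorem lattice_subgroup_lattice:
  assumes "group G" shows "lattice (subgroup_lattice G)"
proof -
  interpret complete_lattice "subgroup_lattice G"
    unfolding subgroup_lattice_def inclusion_order_def
    by (rule group.subgroups_complete_lattice[OF assms])
  show ?thesis by unfold_locales
qed

theorem subgroup_lattice_join:
  assumes "group G" "subgroup H G" "subgroup K G"
  shows "H \<squnion>\<^bsub>subgroup_lattice G\<^esub> K = generate G (H \<union> K)"
proof -
  let ?L = "subgroup_lattice G"
  interpret L: lattice ?L by (rule lattice_subgroup_lattice[OF assms(1)])
  interpret group G by (rule assms(1))
  have sub: "H \<union> K \<subseteq> carrier G" using assms by (auto dest: subgroup.subset)
  have "least ?L (generate G (H \<union> K)) (Upper ?L {H, K})"
    unfolding least_def
  proof (intro conjI ballI)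
    have "H \<union> K \<subseteq> generate G (H \<union> K)" by (rule subsetI) (rule generate.incl)
    then show "generate G (H \<union> K) \<in> Upper ?L {H, K}"
      using generate_is_subgroup[OF sub]
      by (auto simp add: Upper_def subgroup_lattice_def inclusion_order_def)
    show "Upper ?L {H, K} \<subseteq> carrier ?L" by (rule Upper_closed)
    fix M assume "M \<in> Upper ?L {H, K}"
    then have "subgroup M G" "H \<union> K \<subseteq> M"
      using assms(2,3) unfolding Upper_def subgroup_lattice_def inclusion_order_def by auto
    then have "generate G (H \<union> K) \<subseteq> M" by (intro generate_subgroup_incl)
    then show "generate G (H \<union> K) \<sqsubseteq>\<^bsub>?L\<^esub> M"
      unfolding subgroup_lattice_def inclusion_order_def by simp
  qed
  then show ?thesis
    unfolding join_def Lattice.sup_def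
    by (intro some_equality) (simp_all add: L.least_unique)
qed

theorem subgroup_lattice_meet:
  assumes "group G" "subgroup H G" "subgroup K G"
  shows "H \<sqinter>\<^bsub>subgroup_lattice G\<^esub> K = H \<inter> K"
proof -
  let ?L = "subgroup_lattice G"
  interpret L: lattice ?L by (rule lattice_subgroup_lattice[OF assms(1)])
  interpret group G by (rule assms(1))
  have "greatest ?L (H \<inter> K) (Lower ?L {H, K})"
    using assms subgroups_Inter_pair
    by (auto simp: greatest_def Lower_def subgroup_lattice_def inclusion_order_def)
  then show ?thesis
    unfolding meet_def Lattice.inf_def
    by (intro some_equality) (simp_all add: L.greatest_unique)
qed

end

theory Submission
  imports Defs "HOL-Combinatorics.Transposition"
begin

text \<open>
  Every cluster quiver of type \<open>A\<close> can be drawn on a tree: its vertices are edges \<open>e i\<close> of a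
  tree, two of them are joined by an arrow, which is then simple, exactly when the two edges
  share a point, and three edges at one point form an oriented 3-cycle. (For a quiver that comes
  from a triangulated polygon, the points are the triangles and the edge of a diagonal joins the
  triangles on its two sides.) An oriented path has such a model, a mutation at \<open>v\<close> is obtained
  by sliding each edge \<open>e j\<close> with an arrow \<open>j \<rightarrow> v\<close> along \<open>e v\<close> to the other end of \<open>e v\<close>, and
  the trees of the components of \<open>Q\<close> together form a forest.

  Sending \<open>t\<^sub>i\<close> to the transposition of the two ends of \<open>e i\<close> respects the defining relations,
  because the only chordless cycles of such a quiver are the triangles at a common point.
  Removing the edge \<open>e i\<close> from the forest yields a cut: a set of points which separates the ends
  of \<open>e i\<close> and of no other edge. The theorem rests on the description of the parabolic subgroups
  by cuts in \<open>generated_iff_preserves_cuts\<close>: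

  \<^item> an element lies in \<open>G\<^sub>I\<close> if and only if its permutation preserves every cut of every edge
    that is not in \<open>I\<close>.

  The condition for \<open>I \<inter> J\<close> is the conjunction of the conditions for \<open>I\<close> and for \<open>J\<close>, whence
  \<open>G\<^sub>I \<inter> G\<^sub>J = G\<^bsub>I \<inter> J\<^esub>\<close>; and \<open>t\<^sub>i\<close> moves the ends of \<open>e i\<close> across a cut of \<open>e i\<close>, so that
  \<open>t\<^sub>i \<in> G\<^sub>I\<close> only for \<open>i \<in> I\<close>. Thus \<open>I \<mapsto> G\<^sub>I\<close> is an order embedding, hence a lattice
  isomorphism onto its image; that joins are preserved is clear.

  One direction of the description is immediate. The other one contains, for \<open>I = {}\<close>, that the
  permutation determines the group element. Its proof constructs, for all points \<open>x\<close>, \<open>y\<close> of one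
  tree, an element \<open>\<tau> x y\<close> of the group such that these elements conjugate one another as
  transpositions do (\<open>transposition_family_exists\<close>). Every product of generators then has the
  form \<open>\<tau> x y \<otimes> h\<close>, where \<open>h\<close> is a product of elements \<open>\<tau> a b\<close> with \<open>a\<close>, \<open>b\<close> different from a
  given point \<open>x\<close>. Its permutation maps \<open>x\<close> to \<open>y\<close>. If this permutation preserves the cuts
  outside \<open>I\<close>, then no such cut separates \<open>x\<close> from \<open>y\<close>, the path from \<open>x\<close> to \<open>y\<close> uses only edges
  in \<open>I\<close>, and \<open>\<tau> x y\<close> lies in \<open>G\<^sub>I\<close>. Now \<open>h\<close> satisfies the same condition and involves fewer
  points.
\<close>

section \<open>Forests of edges and their cuts\<close>

definition separates :: "'a set \<Rightarrow> 'a set \<Rightarrow> bool" where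
  "separates S A \<longleftrightarrow> A \<inter> S \<noteq> {} \<and> A - S \<noteq> {}"

definition is_cut :: "'v set \<Rightarrow> ('v \<Rightarrow> 'a set) \<Rightarrow> 'v \<Rightarrow> 'a set \<Rightarrow> bool" where
  "is_cut E e i S \<longleftrightarrow> (\<forall>j \<in> E. separates S (e j) \<longleftrightarrow> j = i)"

text \<open>The existence of cuts expresses that the edges form no cycle and that no two of them are
  parallel. Unlike paths and cycles, cuts are easily followed through a mutation, and they are
  what describes the parabolic subgroups.\<close>

definition forest :: "'v set \<Rightarrow> ('v \<Rightarrow> 'a set) \<Rightarrow> bool" where
  "forest E e \<longleftrightarrow> finite E \<and> (\<forall>i \<in> E. card (e i) = 2 \<and> (\<exists>S. is_cut E e i S))"

lemma separates_pair: "separates S {x, y} \<longleftrightarrow> (x \<in> S) \<noteq> (y \<in> S)"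
  by (auto simp: separates_def)

lemma separates_Compl: "separates (- S) A \<longleftrightarrow> separates S A"
  by (auto simp: separates_def)

lemma is_cut_Compl: "is_cut E e i (- S) \<longleftrightarrow> is_cut E e i S"
  by (simp add: is_cut_def separates_Compl)

lemma is_cut_same_side:
  assumes "is_cut E e i S" "j \<in> E" "j \<noteq> i" "x \<in> e j" "y \<in> e j"
  shows "x \<in> S \<longleftrightarrow> y \<in> S"
  using assms by (auto simp: is_cut_def separates_def)

lemma is_cut_ends:
  assumes "is_cut E e i S" "i \<in> E" "e i = {x, y}"
  shows "x \<in> S \<longleftrightarrow> y \<notin> S"
  using assms by (auto simp: is_cut_def separates_pair)

lemma is_cut_subset: "is_cut E e i S \<Longrightarrow> F \<subseteq> E \<Longrightarrow> is_cut F e i S"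
  by (simp add: is_cut_def subset_iff)

lemma forest_subset:
  assumes "forest E e" "F \<subseteq> E"
  shows "forest F e"
  unfolding forest_def
proof (intro conjI ballI)
  show "finite F" using assms finite_subset by (auto simp: forest_def)
  fix i assume "i \<in> F"
  then have i: "i \<in> E" using assms(2) by blast
  then show "card (e i) = 2" using assms(1) by (simp add: forest_def)
  obtain S where "is_cut E e i S" using assms(1) i unfolding forest_def by blast
  then have "is_cut F e i S" using assms(2) by (rule is_cut_subset)
  then show "\<exists>S. is_cut F e i S" ..
qed

lemma forest_cut:
  assumes "forest E e" "i \<in> E"
  obtains S where "is_cut E e i S"
  using assms by (auto simp: forest_def)

lemma forest_ends':
  assumes "forest E e" "i \<in> E"
  obtains x y where "e i = {x, y}" "x \<noteq> y"
proof -
  have "card (e i) = 2" using assms by (simp add: forest_def)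
  then show ?thesis using that by (auto simp: card_2_iff)
qed

lemma forest_ends:
  assumes "forest E e" "i \<in> E" "x \<in> e i"
  obtains y where "e i = {x, y}" "x \<noteq> y"
proof -
  obtain a b where "e i = {a, b}" "a \<noteq> b" using assms(1,2) by (rule forest_ends')
  then show ?thesis using that[of a] that[of b] assms(3) by (auto simp: insert_commute)
qed

lemma forest_endsD: "forest E e \<Longrightarrow> i \<in> E \<Longrightarrow> e i = {x, y} \<Longrightarrow> x \<noteq> y"
  by (auto simp: forest_def)

text \<open>With \<open>j = k\<close> this also bounds the number of points shared by two edges (\<open>forest_share_unique\<close>
  below). The points \<open>x\<close> and \<open>y\<close> are joined by way of \<open>z\<close> without using \<open>e i\<close>, so a cut of \<open>e i\<close>
  does not separate them.\<close>

lemma forest_no_triangle: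
  assumes "forest E e" "i \<in> E" "j \<in> E" "k \<in> E" "i \<noteq> j" "i \<noteq> k"
    and "x \<in> e i" "x \<in> e j" "y \<in> e i" "y \<in> e k" "z \<in> e j" "z \<in> e k"
  shows "x = y"
proof (rule ccontr)
  assume "x \<noteq> y"
  obtain y' where "e i = {x, y'}" using assms(1,2,7) by (rule forest_ends)
  then have ends: "e i = {x, y}" using assms(9) \<open>x \<noteq> y\<close> by auto
  obtain S where S: "is_cut E e i S" using assms(1,2) by (rule forest_cut)
  have "x \<in> S \<longleftrightarrow> z \<in> S" using S assms(3,5,8,11) by (intro is_cut_same_side[of E e i S j]) auto
  moreover have "y \<in> S \<longleftrightarrow> z \<in> S"
    using S assms(4,6,10,12) by (intro is_cut_same_side[of E e i S k]) auto
  ultimately show False using is_cut_ends[OF S assms(2) ends] by blast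
qed

lemma forest_share_unique:
  assumes "forest E e" "i \<in> E" "j \<in> E" "i \<noteq> j" "x \<in> e i" "x \<in> e j" "y \<in> e i" "y \<in> e j"
  shows "x = y"
  using assms forest_no_triangle[of E e i j j x y x] by blast

text \<open>Among all edges with a chosen end and a cut containing that end, take one whose cut contains
  the fewest edges. A further edge at the chosen end would lie inside the cut, and the
  intersection with one of its own cuts would contain fewer edges still.\<close>

lemma forest_leaf:
  assumes F: "forest E e" and "E \<noteq> {}"
  obtains i l where "i \<in> E" "l \<in> e i" "\<And>j. j \<in> E \<Longrightarrow> j \<noteq> i \<Longrightarrow> l \<notin> e j"
proof -
  define P where "P = (\<lambda>(i, x, S). i \<in> E \<and> x \<in> e i \<and> x \<in> S \<and> is_cut E e i S)"
  define m where "m = (\<lambda>(i :: 'a, x :: 'b, S). card {j \<in> E. e j \<subseteq> S})"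
  have "\<exists>p. P p"
  proof -
    obtain i where i: "i \<in> E" using \<open>E \<noteq> {}\<close> by blast
    obtain S where S: "is_cut E e i S" using F i by (rule forest_cut)
    then obtain x where "x \<in> e i" "x \<in> S" using i unfolding is_cut_def separates_def by blast
    then have "P (i, x, S)" using i S by (simp add: P_def)
    then show ?thesis ..
  qed
  then obtain p where p: "P p" and min: "\<And>q. P q \<Longrightarrow> m p \<le> m q"
    using ex_has_least_nat[of P _ m] by blast
  obtain i x S where pe: "p = (i, x, S)" by (cases p) auto
  have i: "i \<in> E" "x \<in> e i" "x \<in> S" and S: "is_cut E e i S" using p by (auto simp: P_def pe)
  have "x \<notin> e j" if j: "j \<in> E" "j \<noteq> i" for j
  proof
    assume xj: "x \<in> e j"
    obtain y where y: "e j = {x, y}" "x \<noteq> y" using F j(1) xj by (rule forest_ends)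
    obtain z where z: "e i = {x, z}" "x \<noteq> z" using F i(1,2) by (rule forest_ends)
    have yS: "y \<in> S" using is_cut_same_side[OF S j, of x y] i y by simp
    have zS: "z \<notin> S" using is_cut_ends[OF S i(1) z(1)] i by simp
    obtain T' where T': "is_cut E e j T'" using F j(1) by (rule forest_cut)
    obtain T where T: "is_cut E e j T" "y \<in> T"
      using T' is_cut_Compl[of E e j T'] by (cases "y \<in> T'") auto
    have xT: "x \<notin> T" using is_cut_ends[OF T(1) j(1) y(1)] T(2) by simp
    have "is_cut E e j (S \<inter> T)"
      unfolding is_cut_def
    proof (intro ballI iffI)
      fix k assume k: "k \<in> E" "k = j"
      show "separates (S \<inter> T) (e k)" using k y yS T xT by (auto simp: separates_def)
    next
      fix k assume k: "k \<in> E" "separates (S \<inter> T) (e k)"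
      show "k = j"
      proof (rule ccontr)
        assume kj: "k \<noteq> j"
        then have "k \<noteq> i" using k z zS xT i by (auto simp: separates_def)
        then show False
          using k kj is_cut_same_side[OF S k(1)] is_cut_same_side[OF T(1) k(1)]
          by (auto simp: separates_def)
      qed
    qed
    then have "P (j, y, S \<inter> T)" using j y yS T by (simp add: P_def)
    then have "m p \<le> m (j, y, S \<inter> T)" by (rule min)
    moreover have "{k \<in> E. e k \<subseteq> S \<inter> T} \<subset> {k \<in> E. e k \<subseteq> S}"
    proof -
      have "j \<in> {k \<in> E. e k \<subseteq> S}" "j \<notin> {k \<in> E. e k \<subseteq> S \<inter> T}"
        using j y yS i xT by auto
      then show ?thesis by blast
    qed
    then have "m (j, y, S \<inter> T) < m p"
      using F by (auto simp: m_def pe forest_def intro!: psubset_card_mono)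
    ultimately show False by simp
  qed
  then show ?thesis using that i by blast
qed

definition adjacent :: "'v set \<Rightarrow> ('v \<Rightarrow> 'a set) \<Rightarrow> 'a \<Rightarrow> 'a \<Rightarrow> bool" where
  "adjacent E e x y \<longleftrightarrow> (\<exists>i \<in> E. e i = {x, y})"

abbreviation connected_by :: "'v set \<Rightarrow> ('v \<Rightarrow> 'a set) \<Rightarrow> 'a \<Rightarrow> 'a \<Rightarrow> bool" where
  "connected_by E e \<equiv> (adjacent E e)\<^sup>*\<^sup>*"

lemma connected_by_sym: "connected_by E e x y \<Longrightarrow> connected_by E e y x"
proof -
  have "symp (adjacent E e)" by (auto simp: symp_def adjacent_def insert_commute)
  then show "connected_by E e x y \<Longrightarrow> connected_by E e y x"
    by (metis symp_rtranclp sympD)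
qed

lemma connected_by_mono: "E \<subseteq> F \<Longrightarrow> connected_by E e x y \<Longrightarrow> connected_by F e x y"
  by (erule predicate2D[OF rtranclp_mono, rotated]) (unfold adjacent_def, blast)

lemma connected_by_edge: "i \<in> E \<Longrightarrow> e i = {x, y} \<Longrightarrow> connected_by E e x y"
  by (rule r_into_rtranclp) (auto simp: adjacent_def)

lemma connected_by_transpose:
  assumes "connected_by E e x y"
  shows "connected_by E e z (transpose x y z)"
  using assms connected_by_sym[OF assms] by (auto simp: transpose_def)

lemma connected_by_transpose2:
  assumes "connected_by E e x y" "connected_by E e z w"
  shows "connected_by E e (transpose x y z) (transpose x y w)"
  using assms connected_by_transpose[OF assms(1)] connected_by_sym by (metis rtranclp_trans)

text \<open>A walk changes sides of the cut only by traversing \<open>e i\<close>. The induction along the walk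
  therefore records, while the walk is on the far side, that it can be cut at the two ends of
  \<open>e i\<close>.\<close>

lemma connected_by_remove:
  assumes F: "forest E e" and i: "i \<in> E" and S: "is_cut E e i S"
    and xy: "connected_by E e x y" and side: "x \<in> S \<longleftrightarrow> y \<in> S"
  shows "connected_by (E - {i}) e x y"
proof -
  let ?c = "connected_by (E - {i}) e"
  have main: "\<forall>a b. e i = {a, b} \<longrightarrow> (a \<in> S \<longleftrightarrow> x \<in> S) \<longrightarrow>
      (if y \<in> S \<longleftrightarrow> x \<in> S then ?c x y else ?c x a \<and> ?c b y)"
    using xy
  proof (induction rule: rtranclp_induct)
    case base
    then show ?case by simp
  next
    case (step y z)
    show ?case
    proof (intro allI impI)
      fix a b assume ab: "e i = {a, b}" "a \<in> S \<longleftrightarrow> x \<in> S"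
      have IH: "if y \<in> S \<longleftrightarrow> x \<in> S then ?c x y else ?c x a \<and> ?c b y"
        using step.IH ab by blast
      have ab': "b \<in> S \<longleftrightarrow> x \<notin> S" using is_cut_ends[OF S i ab(1)] ab(2) by blast
      obtain j where j: "j \<in> E" "e j = {y, z}" using step.hyps(2) by (auto simp: adjacent_def)
      show "if z \<in> S \<longleftrightarrow> x \<in> S then ?c x z else ?c x a \<and> ?c b z"
      proof (cases "j = i")
        case True
        then have "y = a \<and> z = b \<or> y = b \<and> z = a" using j ab by (auto simp: doubleton_eq_iff)
        then show ?thesis using IH ab(2) ab' by (auto split: if_splits)
      next
        case False
        then have "y \<in> S \<longleftrightarrow> z \<in> S" using is_cut_same_side[OF S j(1)] j(2) by blast
        moreover have "?c y z" using j False by (intro connected_by_edge[of j]) auto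
        ultimately show ?thesis using IH by (auto split: if_splits intro: rtranclp_trans)
      qed
    qed
  qed
  obtain u v where uv: "e i = {u, v}" using F i by (rule forest_ends')
  then have "u \<in> S \<longleftrightarrow> v \<notin> S" using is_cut_ends[OF S i] by blast
  then have "\<exists>a b. e i = {a, b} \<and> (a \<in> S \<longleftrightarrow> x \<in> S)" using uv by (metis insert_commute)
  then show ?thesis using main side by auto
qed

text \<open>In a forest the edges on the path from \<open>x\<close> to \<open>y\<close> are precisely those whose cuts separate \<open>x\<close>
  from \<open>y\<close>; all other edges can be removed one after the other.\<close>

lemma connected_by_unseparated:
  assumes F: "forest E e" and I: "I \<subseteq> E" and xy: "connected_by E e x y"
    and side: "\<And>i S. i \<in> E - I \<Longrightarrow> is_cut E e i S \<Longrightarrow> x \<in> S \<longleftrightarrow> y \<in> S"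
  shows "connected_by I e x y"
proof -
  have fin: "finite (E - I)" using F by (simp add: forest_def)
  have "connected_by (E - D) e x y" if "finite D" "D \<subseteq> E - I" for D
    using that
  proof (induction rule: finite_induct)
    case empty
    then show ?case using xy by simp
  next
    case (insert i D)
    obtain S where S: "is_cut E e i S" using F insert.prems by (auto elim: forest_cut)
    then have S': "is_cut (E - D) e i S" by (simp add: is_cut_def)
    have "connected_by (E - D - {i}) e x y"
      using insert forest_subset[OF F] S' side[OF _ S]
      by (intro connected_by_remove[of _ _ _ S]) auto
    moreover have "E - D - {i} = E - insert i D" by blast
    ultimately show ?case by simp
  qed
  from this[OF fin] have "connected_by (E - (E - I)) e x y" by simp
  moreover have "E - (E - I) = I" using I by blast
  ultimately show ?thesis by simp
qed


section \<open>Transpositions from generators at the edges of a forest\<close>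

text \<open>These are the laws of conjugation among the involutions of a group, with \<open>x \<rhd> y\<close> for \<open>x y x\<close>
  and \<open>u\<close> for the unit element. The transposition-like elements are constructed by conjugation
  alone, and self-distributivity replaces computations with long products. The law \<open>act_commute\<close>
  does not hold in all involutory quandles; it is what makes commuting a symmetric relation.\<close>

locale involutory_quandle =
  fixes M :: "'g set" and act :: "'g \<Rightarrow> 'g \<Rightarrow> 'g" (infixr "\<rhd>" 70) and u :: 'g
  assumes act_closed: "x \<in> M \<Longrightarrow> y \<in> M \<Longrightarrow> x \<rhd> y \<in> M"
    and act_self: "x \<in> M \<Longrightarrow> x \<rhd> x = x"
    and act_act: "x \<in> M \<Longrightarrow> y \<in> M \<Longrightarrow> x \<rhd> (x \<rhd> y) = y"
    and act_distrib: "x \<in> M \<Longrightarrow> y \<in> M \<Longrightarrow> z \<in> M \<Longrightarrow> x \<rhd> (y \<rhd> z) = (x \<rhd> y) \<rhd> (x \<rhd> z)"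
    and act_commute: "x \<in> M \<Longrightarrow> y \<in> M \<Longrightarrow> x \<rhd> y = y \<Longrightarrow> y \<rhd> x = x"
    and unit_closed: "u \<in> M"
    and unit_act: "x \<in> M \<Longrightarrow> u \<rhd> x = x"
    and act_unit: "x \<in> M \<Longrightarrow> x \<rhd> u = u"
begin

lemma act_of_act: "x \<in> M \<Longrightarrow> y \<in> M \<Longrightarrow> z \<in> M \<Longrightarrow> (x \<rhd> y) \<rhd> z = x \<rhd> (y \<rhd> (x \<rhd> z))"
  using act_distrib[of x y "x \<rhd> z"] by (simp add: act_closed act_act)

text \<open>The last condition stands for the relation of an oriented 3-cycle. The two are equivalent in
  the presence of the braid relations, but this form does not refer to an orientation.\<close>

definition tree_relations :: "'v set \<Rightarrow> ('v \<Rightarrow> 'a set) \<Rightarrow> ('v \<Rightarrow> 'g) \<Rightarrow> bool" where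
  "tree_relations E e t \<longleftrightarrow>
     (\<forall>i \<in> E. t i \<in> M) \<and>
     (\<forall>i \<in> E. \<forall>j \<in> E. e i \<inter> e j = {} \<longrightarrow> t i \<rhd> t j = t j) \<and>
     (\<forall>i \<in> E. \<forall>j \<in> E. i \<noteq> j \<longrightarrow> e i \<inter> e j \<noteq> {} \<longrightarrow> t i \<rhd> t j = t j \<rhd> t i) \<and>
     (\<forall>i \<in> E. \<forall>j \<in> E. \<forall>k \<in> E. i \<noteq> j \<longrightarrow> i \<noteq> k \<longrightarrow> j \<noteq> k \<longrightarrow> e i \<inter> e j \<inter> e k \<noteq> {} \<longrightarrow>
        t i \<rhd> t j \<rhd> t k = t j \<rhd> t k)"

text \<open>Since \<open>transpose x x = id\<close>, the value \<open>u\<close> on the diagonal makes the conjugation law hold for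
  all points, whether or not they coincide.\<close>

definition transposition_family ::
  "'v set \<Rightarrow> ('v \<Rightarrow> 'a set) \<Rightarrow> ('v \<Rightarrow> 'g) \<Rightarrow> ('a \<Rightarrow> 'a \<Rightarrow> 'g) \<Rightarrow> bool" where
  "transposition_family E e t \<tau> \<longleftrightarrow>
     (\<forall>x y. connected_by E e x y \<longrightarrow> \<tau> x y \<in> M) \<and>
     (\<forall>x. \<tau> x x = u) \<and>
     (\<forall>x y. connected_by E e x y \<longrightarrow> \<tau> y x = \<tau> x y) \<and>
     (\<forall>x y z w. connected_by E e x y \<longrightarrow> connected_by E e z w \<longrightarrow>
        \<tau> x y \<rhd> \<tau> z w = \<tau> (transpose x y z) (transpose x y w)) \<and>
     (\<forall>i \<in> E. \<forall>x y. e i = {x, y} \<longrightarrow> \<tau> x y = t i)"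

lemma tree_relations_braid:
  assumes "tree_relations E e t" "i \<in> E" "j \<in> E" "i \<noteq> j" "e i \<inter> e j \<noteq> {}"
  shows "t i \<rhd> t j = t j \<rhd> t i"
  using assms unfolding tree_relations_def by blast

lemma tree_relations_subset:
  assumes R: "tree_relations E e t" and FE: "F \<subseteq> E"
  shows "tree_relations F e t"
  unfolding tree_relations_def
proof (intro conjI ballI impI)
  fix i j assume "i \<in> F" "j \<in> F" "i \<noteq> j" "e i \<inter> e j \<noteq> {}"
  then show "t i \<rhd> t j = t j \<rhd> t i" using tree_relations_braid[OF R] FE by blast
qed (use R FE in \<open>simp_all add: tree_relations_def subset_iff\<close>)

text \<open>Let \<open>l\<close> be a leaf, attached at \<open>p\<close> by the edge \<open>e i\<close>. The transposition of \<open>l\<close> and \<open>x\<close> has to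
  be the conjugate of \<open>t i\<close> by \<open>\<tau> p x\<close>; this is \<open>\<rho> x\<close> in the proof. Everything follows once
  \<open>t i\<close> is known to commute with each \<open>\<tau> x y\<close> for \<open>x\<close>, \<open>y\<close> different from \<open>p\<close>. To see this,
  follow a walk from \<open>x\<close> to \<open>y\<close>. Edges that avoid \<open>p\<close> are disjoint from \<open>e i\<close>, and their
  generators commute with \<open>t i\<close>; two consecutive edges of the walk through \<open>p\<close> form a star with
  \<open>e i\<close>, and the star relation allows the walk to jump over \<open>p\<close>.\<close>

lemma add_leaf:
  assumes F: "forest E e" and R: "tree_relations E e t"
    and i: "i \<in> E" "e i = {l, p}" "l \<noteq> p" and leaf: "\<And>j. j \<in> E \<Longrightarrow> j \<noteq> i \<Longrightarrow> l \<notin> e j"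
    and T: "transposition_family (E - {i}) e t \<tau>"
  shows "\<exists>\<tau>'. transposition_family E e t \<tau>'"
proof -
  let ?E = "E - {i}"
  let ?c = "connected_by ?E e"
  let ?t = "t i"
  have FE: "forest ?E e" using F by (rule forest_subset) blast
  have tM: "?t \<in> M" using R i by (simp add: tree_relations_def)
  have TM: "\<tau> x y \<in> M" if "?c x y" for x y using T that by (simp add: transposition_family_def)
  have Tu: "\<tau> x x = u" for x using T by (simp add: transposition_family_def)
  have Tsym: "\<tau> y x = \<tau> x y" if "?c x y" for x y
    using T that by (simp add: transposition_family_def)
  have Tact: "\<tau> x y \<rhd> \<tau> z w = \<tau> (transpose x y z) (transpose x y w)" if "?c x y" "?c z w" for x y z w
    using T that by (simp add: transposition_family_def)
  have Tt: "\<tau> x y = t j" if "j \<in> ?E" "e j = {x, y}" for j x y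
    using T that by (simp add: transposition_family_def)
  have disj: "e i \<inter> e j = {}" if "j \<in> ?E" "p \<notin> e j" for j
    using i leaf that by auto
  have meet: "e i \<inter> e j \<noteq> {}" if "p \<in> e j" for j
    using i that by auto

  have comm_trans: "?t \<rhd> \<tau> x z = \<tau> x z"
    if "?c x y" "?c y z" "?t \<rhd> \<tau> x y = \<tau> x y" "?t \<rhd> \<tau> y z = \<tau> y z" for x y z
  proof (cases "x = y \<or> y = z \<or> x = z")
    case True
    then show ?thesis using that Tu act_unit[OF tM] by auto
  next
    case False
    then have "z \<noteq> x" "z \<noteq> y" by auto
    then have "\<tau> x z = \<tau> x y \<rhd> \<tau> y z" using Tact[OF that(1,2)] by simp
    then show ?thesis using that TM tM act_distrib[of ?t "\<tau> x y" "\<tau> y z"] by simp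
  qed
  have comm: "?t \<rhd> \<tau> x y = \<tau> x y" if xy: "?c x y" and x: "x \<noteq> p" and y: "y \<noteq> p" for x y
  proof -
    \<comment> \<open>When the walk has reached \<open>p\<close>, the claim is stated for all neighbours of \<open>p\<close>
      instead, as the claim for \<open>p\<close> itself is false.\<close>
    have "(y \<noteq> p \<longrightarrow> ?t \<rhd> \<tau> x y = \<tau> x y) \<and>
          (y = p \<longrightarrow> (\<forall>q j. j \<in> ?E \<longrightarrow> e j = {p, q} \<longrightarrow> ?t \<rhd> \<tau> x q = \<tau> x q))"
      using xy
    proof (induction rule: rtranclp_induct)
      case base
      then show ?case using x Tu act_unit[OF tM] by simp
    next
      case (step y z)
      obtain j where j: "j \<in> ?E" "e j = {y, z}" using step.hyps(2) by (auto simp: adjacent_def)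
      have yz: "y \<noteq> z" using FE j by (rule forest_endsD)
      have cyz: "?c y z" using j by (rule connected_by_edge)
      show ?case
      proof (cases "y = p")
        case True
        then show ?thesis using step.IH j yz by auto
      next
        case yp: False
        have IH: "?t \<rhd> \<tau> x y = \<tau> x y" using step.IH yp by simp
        show ?thesis
        proof (cases "z = p")
          case False
          have "?t \<rhd> t j = t j"
            using R i(1) j disj[OF j(1)] yp False unfolding tree_relations_def by auto
          then have "?t \<rhd> \<tau> y z = \<tau> y z" using Tt[OF j] by simp
          then show ?thesis using comm_trans[OF step.hyps(1) cyz IH] False by blast
        next
          case zp: True
          have "?t \<rhd> \<tau> x q = \<tau> x q" if k: "k \<in> ?E" "e k = {p, q}" for q k
          proof (cases "q = y")
            case True
            then show ?thesis using IH by simp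
          next
            case qy: False
            then have jk: "j \<noteq> k" using j k zp yz by (auto simp: doubleton_eq_iff)
            have pq: "p \<noteq> q" using FE k by (rule forest_endsD)
            have cpq: "?c p q" using k by (rule connected_by_edge)
            have "p \<in> e i \<inter> e j \<inter> e k" using i j k zp by auto
            then have tri: "?t \<rhd> t j \<rhd> t k = t j \<rhd> t k"
              using R i j(1) k(1) jk unfolding tree_relations_def by (metis DiffE empty_iff singletonI)
            have "t j \<rhd> t k = \<tau> y p \<rhd> \<tau> p q"
              using Tt[OF j] Tt[OF k] zp by simp
            also have "\<dots> = \<tau> y q" using Tact[of y p p q] cyz cpq zp qy pq by simp
            finally have "?t \<rhd> \<tau> y q = \<tau> y q" using tri by simp
            moreover have "?c y q" using cyz cpq zp by simp
            ultimately show ?thesis using comm_trans[OF step.hyps(1) _ IH] by blast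
          qed
          then show ?thesis using zp by blast
        qed
      qed
    qed
    then show ?thesis using y by blast
  qed

  define \<rho> where "\<rho> x = \<tau> p x \<rhd> ?t" for x
  have \<rho>M: "\<rho> x \<in> M" if "?c p x" for x using that TM tM act_closed by (simp add: \<rho>_def)
  have \<rho>p: "\<rho> p = ?t" using Tu unit_act tM by (simp add: \<rho>_def)

  have act_\<rho>0: "\<tau> x y \<rhd> \<rho> w = \<rho> (transpose x y w)"
    if "?c x y" "?c p w" "x \<noteq> p" "y \<noteq> p" for x y w
  proof -
    have "\<tau> x y \<rhd> ?t = ?t" using comm[of x y] that act_commute TM tM by blast
    moreover have "\<tau> x y \<rhd> \<tau> p w = \<tau> p (transpose x y w)" using Tact[of x y p w] that by simp
    ultimately show ?thesis
      using that TM tM act_distrib[of "\<tau> x y" "\<tau> p w" ?t] by (simp add: \<rho>_def)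
  qed
  have act_\<rho>1: "\<tau> p y \<rhd> \<rho> w = \<rho> (transpose p y w)"
    if "?c p y" "?c p w" "y \<noteq> p" for y w
  proof -
    consider "w = p" | "w = y" | "w \<noteq> p" "w \<noteq> y" by blast
    then show ?thesis
    proof cases
      case 1
      then show ?thesis using \<rho>p by (simp add: \<rho>_def)
    next
      case 2
      then show ?thesis using \<rho>p that TM tM by (simp add: \<rho>_def act_act)
    next
      case 3
      have cyw: "?c y w" using that connected_by_sym[OF that(1)] by (metis rtranclp_trans)
      have "\<tau> p y \<rhd> \<rho> w = (\<tau> p y \<rhd> \<tau> p w) \<rhd> \<rho> y"
        using that TM tM act_distrib[of "\<tau> p y" "\<tau> p w" ?t] by (simp add: \<rho>_def)
      also have "\<tau> p y \<rhd> \<tau> p w = \<tau> y w" using Tact[of p y p w] that 3 by simp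
      also have "\<tau> y w \<rhd> \<rho> y = \<rho> w" using act_\<rho>0[of y w y] cyw that 3 by simp
      finally show ?thesis using 3 by simp
    qed
  qed
  have act_\<rho>: "\<tau> x y \<rhd> \<rho> w = \<rho> (transpose x y w)"
    if "?c x y" "?c p w" for x y w
  proof -
    consider "x = y" | "x \<noteq> p" "y \<noteq> p" | "x = p" "y \<noteq> p" | "x \<noteq> p" "y = p" by blast
    then show ?thesis
    proof cases
      case 1
      then show ?thesis using Tu unit_act \<rho>M that by simp
    next
      case 4
      then have "?c p x" using that connected_by_sym by metis
      then show ?thesis using act_\<rho>1[of x w] 4 that Tsym[of x y] by (simp add: transpose_commute)
    qed (use act_\<rho>0 act_\<rho>1 that in auto)
  qed

  \<comment> \<open>This is the braid relation of \<open>t i\<close> and \<open>\<tau> p w\<close>. It holds for an edge at \<open>p\<close>, and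
    conjugation with elements that commute with \<open>t i\<close> transports it from there to all
    \<open>w\<close>.\<close>
  have braid: "?t \<rhd> \<tau> p w = \<rho> w" if pw: "?c p w" "w \<noteq> p" for w
  proof -
    obtain q j where j: "j \<in> ?E" "e j = {p, q}"
      using pw by (cases rule: converse_rtranclpE) (auto simp: adjacent_def)
    have pq: "p \<noteq> q" using FE j by (rule forest_endsD)
    have cpq: "?c p q" using j by (rule connected_by_edge)
    have "?t \<rhd> t j = t j \<rhd> ?t"
      using R i(1) j(1) meet[of j] j(2) unfolding tree_relations_def by auto
    then have q: "?t \<rhd> \<tau> p q = \<rho> q" using Tt[OF j] by (simp add: \<rho>_def)
    show ?thesis
    proof (cases "w = q")
      case True
      then show ?thesis using q by simp
    next
      case False
      have cqw: "?c q w" using pw(1) connected_by_sym[OF cpq] by (metis rtranclp_trans)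
      have "\<tau> p w = \<tau> q w \<rhd> \<tau> p q" using Tact[of q w p q] cqw cpq pq pw(2) by simp
      then have "?t \<rhd> \<tau> p w = (?t \<rhd> \<tau> q w) \<rhd> (?t \<rhd> \<tau> p q)"
        using TM tM cqw cpq act_distrib[of ?t "\<tau> q w" "\<tau> p q"] by simp
      also have "\<dots> = \<tau> q w \<rhd> \<rho> q" using comm[of q w] cqw pq pw(2) q by simp
      also have "\<dots> = \<rho> w" using act_\<rho>[of q w q] cqw cpq by simp
      finally show ?thesis .
    qed
  qed

  define \<sigma> where "\<sigma> x y = (if x = l then if y = l then u else \<rho> y
      else if y = l then \<rho> x else \<tau> x y)" for x y
  \<comment> \<open>Contracting the new edge maps walks to walks without it.\<close>
  define \<pi> where "\<pi> x = (if x = l then p else x)" for x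
  have \<pi>: "?c (\<pi> x) (\<pi> y)" if "connected_by E e x y" for x y
    using that
  proof (induction rule: rtranclp_induct)
    case (step y z)
    obtain j where j: "j \<in> E" "e j = {y, z}" using step.hyps(2) by (auto simp: adjacent_def)
    have "?c (\<pi> y) (\<pi> z)"
    proof (cases "j = i")
      case True
      then have "\<pi> y = \<pi> z" using i j by (auto simp: \<pi>_def doubleton_eq_iff)
      then show ?thesis by simp
    next
      case False
      then have "\<pi> y = y" "\<pi> z = z" using leaf[OF j(1)] j(2) by (auto simp: \<pi>_def)
      then show ?thesis using j False by (auto intro: connected_by_edge)
    qed
    then show ?case using step.IH by simp
  qed simp
  have c1: "?c x y" if "connected_by E e x y" "x \<noteq> l" "y \<noteq> l" for x y
    using \<pi>[OF that(1)] that by (simp add: \<pi>_def)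
  have c2: "?c p y" if "connected_by E e l y" "y \<noteq> l" for y
    using \<pi>[OF that(1)] that by (simp add: \<pi>_def)
  have c3: "?c p x" if "connected_by E e x l" "x \<noteq> l" for x
    using c2[OF connected_by_sym[OF that(1)] that(2)] .
  have clp: "connected_by E e l p" using i(1,2) by (rule connected_by_edge)
  have up: "connected_by E e x y" if "?c x y" for x y
    using that by (rule connected_by_mono[rotated]) blast
  have \<sigma>M: "\<sigma> x y \<in> M" if "connected_by E e x y" for x y
    using that unit_closed \<rho>M TM c1 c2 c3 by (auto simp: \<sigma>_def)
  have \<sigma>sym: "\<sigma> y x = \<sigma> x y" if "connected_by E e x y" for x y
    using that c1 Tsym by (auto simp: \<sigma>_def)
  have \<sigma>u: "\<sigma> x x = u" for x by (simp add: \<sigma>_def Tu)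
  \<comment> \<open>That \<open>g\<close> conjugates the whole family as the map \<open>s\<close> prescribes. This passes from \<open>g\<close>
    and \<open>h\<close> to \<open>g \<rhd> h\<close>, so that \<open>\<rho> y\<close> inherits it from \<open>\<tau> p y\<close> and \<open>t i\<close>.\<close>
  define ok where "ok g s \<longleftrightarrow> (\<forall>z w. connected_by E e z w \<longrightarrow> g \<rhd> \<sigma> z w = \<sigma> (s z) (s w))" for g s
  have okI: "ok g s" if gM: "g \<in> M"
    and "\<And>w. connected_by E e l w \<Longrightarrow> w \<noteq> l \<Longrightarrow> g \<rhd> \<sigma> l w = \<sigma> (s l) (s w)"
    and "\<And>z w. ?c z w \<Longrightarrow> z \<noteq> l \<Longrightarrow> w \<noteq> l \<Longrightarrow> z \<noteq> w \<Longrightarrow> g \<rhd> \<tau> z w = \<sigma> (s z) (s w)"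
    and sc: "\<And>z w. connected_by E e z w \<Longrightarrow> connected_by E e (s z) (s w)" for g s
    unfolding ok_def
  proof (intro allI impI)
    fix z w assume zw: "connected_by E e z w"
    consider "z = w" | "z = l" "w \<noteq> l" | "z \<noteq> l" "w = l" | "z \<noteq> l" "w \<noteq> l" "z \<noteq> w" by blast
    then show "g \<rhd> \<sigma> z w = \<sigma> (s z) (s w)"
    proof cases
      case 1
      then show ?thesis using \<sigma>u act_unit gM by simp
    next
      case 2
      then show ?thesis using that zw by simp
    next
      case 3
      then have "g \<rhd> \<sigma> w z = \<sigma> (s w) (s z)" using that connected_by_sym[OF zw] by simp
      then show ?thesis using \<sigma>sym[OF zw] \<sigma>sym[OF sc[OF zw]] by simp
    next
      case 4
      then show ?thesis using that(3)[of z w] c1[OF zw] by (simp add: \<sigma>_def)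
    qed
  qed
  have ok\<tau>: "ok (\<tau> x y) (transpose x y)" if xy: "?c x y" "x \<noteq> l" "y \<noteq> l" for x y
  proof (rule okI)
    show "\<tau> x y \<in> M" using TM xy by simp
    show "\<tau> x y \<rhd> \<sigma> l w = \<sigma> (transpose x y l) (transpose x y w)"
      if "connected_by E e l w" "w \<noteq> l" for w
    proof -
      have "transpose x y w \<noteq> l" using that xy by (auto simp: transpose_def)
      then show ?thesis using that xy act_\<rho>[OF xy(1) c2[OF that]] by (simp add: \<sigma>_def)
    qed
    show "\<tau> x y \<rhd> \<tau> z w = \<sigma> (transpose x y z) (transpose x y w)"
      if "?c z w" "z \<noteq> l" "w \<noteq> l" "z \<noteq> w" for z w
      using Tact[OF xy(1) that(1)] that xy by (auto simp: \<sigma>_def transpose_def)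
    show "connected_by E e (transpose x y z) (transpose x y w)" if "connected_by E e z w" for z w
      using up[OF xy(1)] that by (rule connected_by_transpose2)
  qed
  have okt: "ok ?t (transpose l p)"
  proof (rule okI)
    show "?t \<in> M" by (fact tM)
    show "?t \<rhd> \<sigma> l w = \<sigma> (transpose l p l) (transpose l p w)"
      if w: "connected_by E e l w" "w \<noteq> l" for w
    proof (cases "w = p")
      case True
      then show ?thesis using i(3) \<rho>p act_self[OF tM] by (simp add: \<sigma>_def)
    next
      case False
      have "?t \<rhd> ?t \<rhd> \<tau> p w = \<tau> p w" using c2[OF w] TM tM by (simp add: act_act)
      then have "?t \<rhd> \<rho> w = \<tau> p w" using braid[OF c2[OF w] False] by simp
      then show ?thesis using False w i(3) by (simp add: \<sigma>_def)
    qed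
    show "?t \<rhd> \<tau> z w = \<sigma> (transpose l p z) (transpose l p w)"
      if zw: "?c z w" "z \<noteq> l" "w \<noteq> l" "z \<noteq> w" for z w
    proof -
      consider "z = p" | "w = p" | "z \<noteq> p" "w \<noteq> p" by blast
      then show ?thesis
      proof cases
        case 1
        then show ?thesis using braid[of w] zw by (simp add: \<sigma>_def)
      next
        case 2
        then show ?thesis using braid[of z] zw Tsym[OF zw(1)] connected_by_sym[OF zw(1)]
          by (simp add: \<sigma>_def)
      next
        case 3
        then show ?thesis using comm zw by (simp add: \<sigma>_def)
      qed
    qed
    show "connected_by E e (transpose l p z) (transpose l p w)" if "connected_by E e z w" for z w
      using clp that by (rule connected_by_transpose2)
  qed
  have ok\<rho>: "ok (\<rho> y) (transpose l y)" if y: "?c p y" "y \<noteq> l" for y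
  proof (cases "y = p")
    case True
    then show ?thesis using okt \<rho>p by simp
  next
    case False
    have conj: "transpose p y (transpose l p (transpose p y a)) = transpose l y a" for a
      using False y(2) i(3) transpose_triple[of y l p a] by (simp add: transpose_commute)
    show ?thesis
      unfolding ok_def
    proof (intro allI impI)
      fix z w assume zw: "connected_by E e z w"
      let ?s = "transpose p y" and ?r = "transpose l p"
      have zw1: "connected_by E e (?s z) (?s w)" using up[OF y(1)] zw by (rule connected_by_transpose2)
      have zw2: "connected_by E e (?r (?s z)) (?r (?s w))"
        using clp zw1 by (rule connected_by_transpose2)
      have okpy: "ok (\<tau> p y) ?s" using ok\<tau> y i(3) by simp
      have "\<rho> y \<rhd> \<sigma> z w = \<tau> p y \<rhd> ?t \<rhd> \<tau> p y \<rhd> \<sigma> z w"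
        using TM tM y \<sigma>M zw by (simp add: \<rho>_def act_of_act)
      also have "\<dots> = \<sigma> (?s (?r (?s z))) (?s (?r (?s w)))"
        using okpy okt zw zw1 zw2 by (simp add: ok_def)
      finally show "\<rho> y \<rhd> \<sigma> z w = \<sigma> (transpose l y z) (transpose l y w)"
        by (simp only: conj)
    qed
  qed
  have "transposition_family E e t \<sigma>"
    unfolding transposition_family_def
  proof (intro conjI allI impI ballI)
    fix x y z w assume xy: "connected_by E e x y" and zw: "connected_by E e z w"
    consider "x = y" | "x = l" "y \<noteq> l" | "x \<noteq> l" "y = l" | "x \<noteq> l" "y \<noteq> l" by blast
    then have "ok (\<sigma> x y) (transpose x y)"
    proof cases
      case 1
      then show ?thesis using \<sigma>u unit_act \<sigma>M by (simp add: ok_def)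
    next
      case 2
      then show ?thesis using ok\<rho>[of y] c2[of y] xy by (simp add: \<sigma>_def)
    next
      case 3
      then show ?thesis using ok\<rho>[of x] c3[of x] xy by (simp add: \<sigma>_def transpose_commute)
    next
      case 4
      then show ?thesis using ok\<tau>[of x y] c1[OF xy] by (simp add: \<sigma>_def)
    qed
    then show "\<sigma> x y \<rhd> \<sigma> z w = \<sigma> (transpose x y z) (transpose x y w)"
      using zw by (simp add: ok_def)
  next
    fix j x y assume j: "j \<in> E" "e j = {x, y}"
    show "\<sigma> x y = t j"
    proof (cases "j = i")
      case True
      then have "x = l \<and> y = p \<or> x = p \<and> y = l" using i j by (auto simp: doubleton_eq_iff)
      then show ?thesis using \<rho>p i(3) True by (auto simp: \<sigma>_def)
    next
      case False
      then show ?thesis using leaf[OF j(1)] j Tt[of j x y] by (auto simp: \<sigma>_def)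
    qed
  qed (use \<sigma>M \<sigma>u \<sigma>sym in auto)
  then show ?thesis by blast
qed

text \<open>In the symmetric group the transpositions themselves form such a family. The point is that the
  relations between the generators at the edges already produce one in every group.\<close>

theorem transposition_family_exists:
  assumes "forest E e" "tree_relations E e t"
  shows "\<exists>\<tau>. transposition_family E e t \<tau>"
proof -
  have "finite E" using assms by (simp add: forest_def)
  then show ?thesis using assms
  proof (induction rule: finite_psubset_induct)
    case (psubset E)
    show ?case
    proof (cases "E = {}")
      case True
      have "connected_by {} e x y \<Longrightarrow> x = y" for x y
        by (induction rule: rtranclp_induct) (auto simp: adjacent_def)
      then have "transposition_family E e t (\<lambda>x y. u)"
        using True unit_closed unit_act by (auto simp: transposition_family_def)
      then show ?thesis by blast
    next
      case False
      obtain i l where il: "i \<in> E" "l \<in> e i" "\<And>j. j \<in> E \<Longrightarrow> j \<noteq> i \<Longrightarrow> l \<notin> e j"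
        using forest_leaf[OF psubset.prems(1) False] by metis
      obtain p where p: "e i = {l, p}" "l \<noteq> p" using psubset.prems(1) il(1,2) by (rule forest_ends)
      have "\<exists>\<tau>. transposition_family (E - {i}) e t \<tau>"
        using il(1) psubset.prems
        by (intro psubset.IH) (auto intro: forest_subset tree_relations_subset)
      then show ?thesis using add_leaf[OF psubset.prems il(1) p il(3)] by blast
    qed
  qed
qed

end


section \<open>Groups generated by transpositions along a forest\<close>

context group
begin

definition involutions :: "'a set" where
  "involutions = {g \<in> carrier G. g \<otimes> g = \<one>}"

lemma involutions_carrier: "g \<in> involutions \<Longrightarrow> g \<in> carrier G"
  by (simp add: involutions_def)

lemma involution_cancel:
  assumes "g \<in> involutions" "h \<in> carrier G"
  shows "g \<otimes> (g \<otimes> h) = h"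
  using assms by (simp add: involutions_def m_assoc[symmetric])

lemma involution_inv: "g \<in> involutions \<Longrightarrow> inv g = g"
  by (simp add: involutions_def inv_equality)

lemma involution_square: "g \<in> involutions \<Longrightarrow> g \<otimes> g = \<one>"
  by (simp add: involutions_def)

lemma involution_conj_eq_iff:
  assumes "g \<in> involutions" "h \<in> carrier G" "k \<in> carrier G"
  shows "g \<otimes> h \<otimes> g = k \<longleftrightarrow> g \<otimes> h = k \<otimes> g"
proof
  assume "g \<otimes> h \<otimes> g = k"
  then have "k \<otimes> g = g \<otimes> h \<otimes> (g \<otimes> g)" using assms by (auto simp: involutions_def m_assoc)
  then show "g \<otimes> h = k \<otimes> g" using assms by (simp add: involutions_def)
next
  assume "g \<otimes> h = k \<otimes> g"
  then show "g \<otimes> h \<otimes> g = k" using assms by (simp add: involutions_def m_assoc)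
qed

sublocale conj: involutory_quandle involutions "\<lambda>g h. g \<otimes> h \<otimes> g" \<one>
proof
  note simps = involutions_carrier m_assoc involution_cancel involution_square
  fix x y assume xy: "x \<in> involutions" "y \<in> involutions"
  then have "x \<otimes> y \<otimes> x \<otimes> (x \<otimes> y \<otimes> x) = \<one>" by (simp add: simps)
  then show "x \<otimes> y \<otimes> x \<in> involutions" using xy by (simp add: involutions_def)
  show "x \<otimes> (x \<otimes> y \<otimes> x) \<otimes> x = y" using xy by (simp add: simps)
  show "y \<otimes> x \<otimes> y = x" if "x \<otimes> y \<otimes> x = y"
    using that xy by (simp add: involution_conj_eq_iff involutions_carrier)
  fix z assume "z \<in> involutions"
  then show "x \<otimes> (y \<otimes> z \<otimes> y) \<otimes> x = x \<otimes> y \<otimes> x \<otimes> (x \<otimes> z \<otimes> x) \<otimes> (x \<otimes> y \<otimes> x)"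
    using xy by (simp add: simps)
next
  fix x assume "x \<in> involutions"
  then show "x \<otimes> x \<otimes> x = x" "\<one> \<otimes> x \<otimes> \<one> = x" "x \<otimes> \<one> \<otimes> x = \<one>"
    by (simp_all add: involutions_def)
next
  show "\<one> \<in> involutions" by (simp add: involutions_def)
qed

text \<open>To compute a generated subgroup it is enough to exhibit a set containing the unit element that
  is stable under left multiplication by generators and their inverses.\<close>

lemma generate_left_closed:
  assumes "\<one> \<in> N" "N \<subseteq> carrier G" "A \<subseteq> carrier G"
    and "\<And>a n. a \<in> A \<Longrightarrow> n \<in> N \<Longrightarrow> a \<otimes> n \<in> N \<and> inv a \<otimes> n \<in> N"
  shows "generate G A \<subseteq> N"
proof
  fix g assume g: "g \<in> generate G A"
  then have "\<forall>n \<in> N. g \<otimes> n \<in> N"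
  proof (induction rule: generate.induct)
    case one
    then show ?case using assms(2) by auto
  next
    case (eng h1 h2)
    then show ?case using assms(2) generate_in_carrier[OF assms(3)]
      by (metis m_assoc subsetD)
  qed (use assms(4) in blast)+
  then show "g \<in> N" using assms(1) generate_in_carrier[OF assms(3) g] by force
qed

end

text \<open>The homomorphism \<open>\<phi>\<close> keeps the relations from collapsing the group: the trivial group
  satisfies all of them.\<close>

locale tree_reflection_group = group G for G (structure) +
  fixes E :: "'v set" and e :: "'v \<Rightarrow> 'p set" and t :: "'v \<Rightarrow> 'a" and \<phi> :: "'a \<Rightarrow> 'p \<Rightarrow> 'p"
  assumes forest: "forest E e"
    and t_involution: "i \<in> E \<Longrightarrow> t i \<in> involutions"
    and t_commute: "i \<in> E \<Longrightarrow> j \<in> E \<Longrightarrow> e i \<inter> e j = {} \<Longrightarrow> t i \<otimes> t j = t j \<otimes> t i"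
    and t_braid: "i \<in> E \<Longrightarrow> j \<in> E \<Longrightarrow> i \<noteq> j \<Longrightarrow> e i \<inter> e j \<noteq> {} \<Longrightarrow>
                    t i \<otimes> t j \<otimes> t i = t j \<otimes> t i \<otimes> t j"
    and t_star: "i \<in> E \<Longrightarrow> j \<in> E \<Longrightarrow> k \<in> E \<Longrightarrow> i \<noteq> j \<Longrightarrow> i \<noteq> k \<Longrightarrow> j \<noteq> k \<Longrightarrow>
                    e i \<inter> e j \<inter> e k \<noteq> {} \<Longrightarrow>
                    t i \<otimes> (t j \<otimes> t k \<otimes> t j) = (t j \<otimes> t k \<otimes> t j) \<otimes> t i"
    and perm_one: "\<phi> \<one> = id"
    and perm_mult: "g \<in> carrier G \<Longrightarrow> h \<in> carrier G \<Longrightarrow> \<phi> (g \<otimes> h) = \<phi> g \<circ> \<phi> h"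
    and perm_t: "i \<in> E \<Longrightarrow> e i = {x, y} \<Longrightarrow> \<phi> (t i) = transpose x y"
begin

text \<open>The cuts run over all subsets of the point type. Different cuts of one edge differ by unions
  of trees of the forest, and permutations from the group preserve each tree.\<close>

definition preserves_cuts :: "'v set \<Rightarrow> ('p \<Rightarrow> 'p) \<Rightarrow> bool" where
  "preserves_cuts D f \<longleftrightarrow> (\<forall>i \<in> D. \<forall>S. is_cut E e i S \<longrightarrow> (\<forall>x. f x \<in> S \<longleftrightarrow> x \<in> S))"

lemma t_carrier: "i \<in> E \<Longrightarrow> t i \<in> carrier G"
  using t_involution involutions_carrier by blast

lemma preserves_cuts_generate:
  assumes I: "I \<subseteq> E" and g: "g \<in> generate G (t ` I)"
  shows "preserves_cuts (E - I) (\<phi> g)"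
proof -
  have sub: "t ` I \<subseteq> carrier G" using I t_carrier by blast
  have t: "preserves_cuts (E - I) (\<phi> (t i))" if i: "i \<in> I" for i
    unfolding preserves_cuts_def
  proof (intro ballI allI impI)
    fix j S x assume j: "j \<in> E - I" and S: "is_cut E e j S"
    have iE: "i \<in> E" using i I by blast
    obtain a b where ab: "e i = {a, b}" using forest iE by (rule forest_ends')
    have "a \<in> S \<longleftrightarrow> b \<in> S" using is_cut_same_side[OF S iE] i j ab by blast
    then show "\<phi> (t i) x \<in> S \<longleftrightarrow> x \<in> S" using perm_t[OF iE ab] by (simp add: transpose_def)
  qed
  from g show ?thesis
  proof (induction rule: generate.induct)
    case one
    then show ?case by (simp add: perm_one preserves_cuts_def)
  next
    case (incl h)
    then show ?case using t by blast
  next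
    case (inv h)
    then have "inv h = h" using t_involution I involution_inv by blast
    then show ?case using inv t by auto
  next
    case (eng h1 h2)
    then show ?case
      using perm_mult[of h1 h2] generate_in_carrier[OF sub] by (simp add: preserves_cuts_def)
  qed
qed

lemma relations_hold: "conj.tree_relations E e t"
  unfolding conj.tree_relations_def
proof (intro conjI ballI impI)
  fix i j assume ij: "i \<in> E" "j \<in> E"
  show "t i \<in> involutions" using ij t_involution by blast
  show "t i \<otimes> t j \<otimes> t i = t j" if "e i \<inter> e j = {}"
    using that ij t_commute t_involution t_carrier by (simp add: involution_conj_eq_iff)
  show "t i \<otimes> t j \<otimes> t i = t j \<otimes> t i \<otimes> t j" if "i \<noteq> j" "e i \<inter> e j \<noteq> {}"
    using that ij by (intro t_braid)
  fix k assume k: "k \<in> E" "i \<noteq> j" "i \<noteq> k" "j \<noteq> k" "e i \<inter> e j \<inter> e k \<noteq> {}"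
  show "t i \<otimes> (t j \<otimes> t k \<otimes> t j) \<otimes> t i = t j \<otimes> t k \<otimes> t j"
    using k ij t_star[of i j k] t_involution t_carrier by (subst involution_conj_eq_iff) simp_all
qed

text \<open>The left-to-right implication holds because a generator \<open>t i\<close> only exchanges the ends of
  \<open>e i\<close>, which lie on the same side of the cuts of all other edges. The converse removes the
  points of the forest one by one.\<close>

theorem generated_iff_preserves_cuts:
  assumes I: "I \<subseteq> E" and g: "g \<in> generate G (t ` E)"
  shows "g \<in> generate G (t ` I) \<longleftrightarrow> preserves_cuts (E - I) (\<phi> g)"
proof
  assume "g \<in> generate G (t ` I)"
  then show "preserves_cuts (E - I) (\<phi> g)" by (rule preserves_cuts_generate[OF I])
next
  assume cuts: "preserves_cuts (E - I) (\<phi> g)"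
  obtain \<tau> where T: "conj.transposition_family E e t \<tau>"
    using conj.transposition_family_exists[OF forest relations_hold] by blast
  let ?c = "connected_by E e"
  let ?H = "generate G (t ` I)"
  have H: "subgroup ?H G" using I t_carrier by (intro generate_is_subgroup) blast
  have TM: "\<tau> x y \<in> involutions" if "?c x y" for x y
    using T that by (simp add: conj.transposition_family_def)
  have TC: "\<tau> x y \<in> carrier G" if "?c x y" for x y using TM[OF that] by (rule involutions_carrier)
  have T1: "\<tau> x x = \<one>" for x using T by (simp add: conj.transposition_family_def)
  have Tsym: "\<tau> y x = \<tau> x y" if "?c x y" for x y
    using T that by (simp add: conj.transposition_family_def)
  have Tconj: "\<tau> x y \<otimes> \<tau> z w \<otimes> \<tau> x y = \<tau> (transpose x y z) (transpose x y w)"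
    if "?c x y" "?c z w" for x y z w
    using T that by (simp add: conj.transposition_family_def)
  have Tmove: "\<tau> x y \<otimes> \<tau> z w = \<tau> (transpose x y z) (transpose x y w) \<otimes> \<tau> x y"
    if "?c x y" "?c z w" for x y z w
    using Tconj[OF that] that TM TC connected_by_transpose2[OF that]
    by (simp add: involution_conj_eq_iff)
  have Tt: "\<tau> x y = t j" if "j \<in> E" "e j = {x, y}" for j x y
    using T that by (simp add: conj.transposition_family_def)

  have Tstep: "\<tau> x z = \<tau> y z \<otimes> \<tau> x y \<otimes> \<tau> y z" if "?c x y" "?c y z" "x \<noteq> y" "x \<noteq> z" for x y z
    using Tconj[OF that(2,1)] that by simp
  have TH: "\<tau> x y \<in> ?H" if "connected_by I e x y" for x y
    using that
  proof (induction rule: rtranclp_induct)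
    case base
    then show ?case using T1 subgroup.one_closed[OF H] by simp
  next
    case (step y z)
    obtain j where j: "j \<in> I" "e j = {y, z}" using step.hyps(2) by (auto simp: adjacent_def)
    have cxy: "?c x y" using I step.hyps(1) by (rule connected_by_mono)
    have cyz: "?c y z" using I j by (intro connected_by_edge) auto
    have yz: "\<tau> y z \<in> ?H" using Tt[OF _ j(2)] j(1) I by (metis generate.incl image_eqI subsetD)
    consider "x = y" | "x = z" | "x \<noteq> y" "x \<noteq> z" by blast
    then show ?case
    proof cases
      case 3
      then show ?thesis
        using Tstep[OF cxy cyz] yz step.IH subgroup.m_closed[OF H] by simp
    qed (use yz T1 subgroup.one_closed[OF H] in auto)
  qed
  have perm: "\<phi> (\<tau> x y) = transpose x y" if "?c x y" for x y
    using that
  proof (induction rule: rtranclp_induct)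
    case base
    then show ?case using T1 perm_one by simp
  next
    case (step y z)
    obtain j where j: "j \<in> E" "e j = {y, z}" using step.hyps(2) by (auto simp: adjacent_def)
    have cyz: "?c y z" using j by (rule connected_by_edge)
    have yz: "\<phi> (\<tau> y z) = transpose y z" using Tt[OF j] perm_t[OF j] by simp
    consider "x = y" | "x = z" | "x \<noteq> y" "x \<noteq> z" by blast
    then show ?case
    proof cases
      case 3
      have "\<phi> (\<tau> x z) = transpose y z \<circ> transpose x y \<circ> transpose y z"
        using Tstep[OF step.hyps(1) cyz 3] TC cyz step.hyps(1) yz step.IH by (simp add: perm_mult)
      also have "\<dots> = transpose x z"
        using transpose_comp_triple[of z x y] forest_endsD[OF forest j] 3
        by (simp add: transpose_commute)
      finally show ?thesis .
    qed (use yz T1 perm_one in auto)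
  qed

  \<comment> \<open>The induction removes points from \<open>P\<close> until it is empty and \<open>K P\<close> is trivial.\<close>
  define K where "K P = generate G {\<tau> x y | x y. x \<in> P \<and> y \<in> P \<and> ?c x y}" for P
  have KC: "{\<tau> x y | x y. x \<in> P \<and> y \<in> P \<and> ?c x y} \<subseteq> carrier G" for P using TC by blast
  have K: "subgroup (K P) G" for P unfolding K_def by (rule generate_is_subgroup[OF KC])
  have KT: "\<tau> x y \<in> K P" if "x \<in> P" "y \<in> P" "?c x y" for x y P
    unfolding K_def using that by (intro generate.incl) blast
  have fix_T: "\<phi> (\<tau> a b) x = x" if "a \<in> P" "b \<in> P" "?c a b" "x \<notin> P" for a b x P
  proof -
    have "x \<noteq> a" "x \<noteq> b" using that by auto
    then show ?thesis using perm[OF that(3)] by simp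
  qed
  have fix_out: "\<phi> h x = x" if h: "h \<in> K P" and x: "x \<notin> P" for h x P
    using h unfolding K_def
  proof (induction rule: generate.induct)
    case one
    then show ?case by (simp add: perm_one)
  next
    case (incl h)
    then show ?case using fix_T x by blast
  next
    case (inv h)
    then obtain a b where ab: "h = \<tau> a b" "a \<in> P" "b \<in> P" "?c a b" by blast
    then have "inv h = h" using TM involution_inv by blast
    then show ?case using ab fix_T x by simp
  next
    case (eng h1 h2)
    then show ?case using perm_mult[of h1 h2] generate_in_carrier[OF KC] by simp
  qed
  \<comment> \<open>The permutation of \<open>h\<close> determines \<open>y\<close> as the image of \<open>x\<close>. The set of products of
    this form is stable under left multiplication by the generators of \<open>K (insert x P)\<close>,
    since these move past \<open>\<tau> x y\<close> by conjugating it.\<close>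
  have decompose: "\<exists>y k. y \<in> insert x P \<and> ?c x y \<and> k \<in> K P \<and> h = \<tau> x y \<otimes> k"
    if h: "h \<in> K (insert x P)" and x: "x \<notin> P" for h x P
  proof -
    let ?N = "{\<tau> x y \<otimes> k | y k. y \<in> insert x P \<and> ?c x y \<and> k \<in> K P}"
    have NI: "\<tau> x y \<otimes> k \<in> ?N" if "y \<in> insert x P" "?c x y" "k \<in> K P" for y k using that by blast
    have KCk: "k \<in> carrier G" if "k \<in> K P" for k using K that by (rule subgroup.mem_carrier)
    have K_in: "k \<in> ?N" if "k \<in> K P" for k
      using NI[of x k] that T1 KCk by simp
    have left: "\<tau> a b \<otimes> n \<in> ?N"
      if ab: "a \<in> insert x P" "b \<in> insert x P" "?c a b" and n: "n \<in> ?N" for a b n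
    proof -
      obtain y k where y: "y \<in> insert x P" "?c x y" and k: "k \<in> K P" and nk: "n = \<tau> x y \<otimes> k"
        using n by blast
      note kC = KCk[OF k]
      have pivot: "\<tau> x v \<otimes> n \<in> ?N" if v: "v \<in> P" "?c x v" for v
      proof -
        consider "y = x" | "y = v" | "y \<noteq> x" "y \<noteq> v" by blast
        then show ?thesis
        proof cases
          case 1
          then show ?thesis using NI[of v k] v k nk T1 kC by simp
        next
          case 2
          then have "\<tau> x v \<otimes> n = k" using involution_cancel[OF TM kC] v nk by simp
          then show ?thesis using K_in k by simp
        next
          case 3
          have cyv: "?c y v" using v(2) connected_by_sym[OF y(2)] by (metis rtranclp_trans)
          have "\<tau> x y \<otimes> \<tau> y v = \<tau> (transpose x y y) (transpose x y v) \<otimes> \<tau> x y"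
            using y(2) cyv by (rule Tmove)
          also have "\<tau> (transpose x y y) (transpose x y v) = \<tau> x v"
            using 3 v x by (auto simp: transpose_def)
          finally have "\<tau> x v \<otimes> n = \<tau> x y \<otimes> (\<tau> y v \<otimes> k)"
            using nk TC v y cyv kC by (simp add: m_assoc[symmetric])
          moreover have "\<tau> y v \<otimes> k \<in> K P"
            using KT[of y P v] 3 y v cyv k subgroup.m_closed[OF K] by simp
          ultimately show ?thesis using NI y by simp
        qed
      qed
      consider "a = x" "b = x" | "a = x" "b \<noteq> x" | "a \<noteq> x" "b = x" | "a \<noteq> x" "b \<noteq> x" by blast
      then show ?thesis
      proof cases
        case 1
        then show ?thesis using n T1 TC y kC nk by simp
      next
        case 2
        then show ?thesis using pivot[of b] ab by simp
      next
        case 3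
        then show ?thesis using pivot[of a] ab Tsym[OF ab(3)] connected_by_sym[OF ab(3)] by simp
      next
        case 4
        let ?y = "transpose a b y"
        have "\<tau> a b \<otimes> \<tau> x y = \<tau> x ?y \<otimes> \<tau> a b" using Tmove[OF ab(3) y(2)] 4 by simp
        moreover have cy: "?c x ?y" using connected_by_transpose2[OF ab(3) y(2)] 4 by simp
        ultimately have "\<tau> a b \<otimes> n = \<tau> x ?y \<otimes> (\<tau> a b \<otimes> k)"
          using nk TC ab y kC by (simp add: m_assoc[symmetric])
        moreover have "\<tau> a b \<otimes> k \<in> K P"
          using KT[of a P b] 4 ab k subgroup.m_closed[OF K] by simp
        moreover have "?y \<in> insert x P" using ab y by (auto simp: transpose_def)
        ultimately show ?thesis using NI cy by simp
      qed
    qed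
    have "generate G {\<tau> a b | a b. a \<in> insert x P \<and> b \<in> insert x P \<and> ?c a b} \<subseteq> ?N"
    proof (rule generate_left_closed)
      show "\<one> \<in> ?N" using K_in subgroup.one_closed[OF K] by blast
      show "?N \<subseteq> carrier G" using TC KCk by auto
      show "{\<tau> a b | a b. a \<in> insert x P \<and> b \<in> insert x P \<and> ?c a b} \<subseteq> carrier G" by (rule KC)
      fix c n
      assume "c \<in> {\<tau> a b | a b. a \<in> insert x P \<and> b \<in> insert x P \<and> ?c a b}" and n: "n \<in> ?N"
      then obtain a b where c: "c = \<tau> a b" and ab: "a \<in> insert x P" "b \<in> insert x P" "?c a b"
        by blast
      have "inv c = c" using TM[OF ab(3)] involution_inv c by simp
      then show "c \<otimes> n \<in> ?N \<and> inv c \<otimes> n \<in> ?N" using left[OF ab n] by (simp only: c simp_thms)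
    qed
    then show ?thesis using h unfolding K_def by blast
  qed
  have descend: "h \<in> ?H" if "finite P" "h \<in> K P" "preserves_cuts (E - I) (\<phi> h)" for P h
    using that
  proof (induction P arbitrary: h rule: finite_induct)
    case empty
    then have "h = \<one>" using generate_empty by (simp add: K_def)
    then show ?case using subgroup.one_closed[OF H] by simp
  next
    case (insert x P)
    obtain y k where y: "y \<in> insert x P" "?c x y" and k: "k \<in> K P" and hk: "h = \<tau> x y \<otimes> k"
      using decompose[OF insert.prems(1) insert.hyps(2)] by blast
    have kC: "k \<in> carrier G" using K k by (rule subgroup.mem_carrier)
    have \<phi>h: "\<phi> h = transpose x y \<circ> \<phi> k"
      using hk perm_mult TC y kC perm by simp
    have "\<phi> h x = y" using \<phi>h fix_out[OF k insert.hyps(2)] by simp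
    then have side: "x \<in> S \<longleftrightarrow> y \<in> S" if "i \<in> E - I" "is_cut E e i S" for i S
      using insert.prems(2) that unfolding preserves_cuts_def by blast
    then have "connected_by I e x y" by (rule connected_by_unseparated[OF forest I y(2)])
    then have "\<tau> x y \<in> ?H" by (rule TH)
    moreover have "preserves_cuts (E - I) (\<phi> k)"
      unfolding preserves_cuts_def
    proof (intro ballI allI impI)
      fix i S z assume i: "i \<in> E - I" "is_cut E e i S"
      have "transpose x y (\<phi> k z) \<in> S \<longleftrightarrow> z \<in> S"
        using insert.prems(2) i \<phi>h unfolding preserves_cuts_def by auto
      then show "\<phi> k z \<in> S \<longleftrightarrow> z \<in> S"
        using side[OF i] by (auto simp: transpose_def split: if_splits)
    qed
    then have "k \<in> ?H" using insert.IH k by blast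
    ultimately show ?case using hk subgroup.m_closed[OF H] by simp
  qed
  have "finite (\<Union>(e ` E))"
    using forest unfolding forest_def by (metis card.infinite finite_UN zero_neq_numeral)
  moreover have "g \<in> K (\<Union>(e ` E))"
  proof -
    have "t ` E \<subseteq> {\<tau> x y | x y. x \<in> \<Union>(e ` E) \<and> y \<in> \<Union>(e ` E) \<and> ?c x y}"
    proof
      fix h assume "h \<in> t ` E"
      then obtain i where i: "i \<in> E" "h = t i" by blast
      obtain a b where ab: "e i = {a, b}" using forest i(1) by (rule forest_ends')
      have "h = \<tau> a b" using Tt[OF i(1) ab] i(2) by simp
      moreover have "?c a b" using i(1) ab by (rule connected_by_edge)
      ultimately show "h \<in> {\<tau> x y | x y. x \<in> \<Union>(e ` E) \<and> y \<in> \<Union>(e ` E) \<and> ?c x y}"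
        using i(1) ab by blast
    qed
    then show ?thesis using g mono_generate unfolding K_def by blast
  qed
  ultimately show "g \<in> ?H" using descend cuts by blast
qed

end


section \<open>Tree models and mutation\<close>

lemma cluster_quiver_finite: "cluster_quiver Q \<Longrightarrow> finite (verts Q)"
  by (simp add: cluster_quiver_def)

lemma cluster_quiver_verts: "cluster_quiver Q \<Longrightarrow> arr Q i j > 0 \<Longrightarrow> i \<in> verts Q \<and> j \<in> verts Q"
  unfolding cluster_quiver_def by blast

lemma no_loop: "cluster_quiver Q \<Longrightarrow> arr Q i i = 0"
  unfolding cluster_quiver_def by blast

lemma no_two_cycle:
  assumes "cluster_quiver Q" "arr Q i j > 0"
  shows "arr Q j i = 0"
proof -
  have "\<not> (arr Q i j > 0 \<and> arr Q j i > 0)" using assms(1) unfolding cluster_quiver_def by blast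
  then show ?thesis using assms(2) by simp
qed

lemma no_two_cycle_disj: "cluster_quiver Q \<Longrightarrow> arr Q i j = 0 \<or> arr Q j i = 0"
  using no_two_cycle[of Q i j] by (cases "arr Q i j = 0") simp_all

lemma verts_mutate [simp]: "verts (mutate v Q) = verts Q"
  by (simp add: mutate_def)

lemma arr_mutate_pivot:
  assumes "cluster_quiver Q"
  shows "arr (mutate v Q) v w = arr Q w v" "arr (mutate v Q) w v = arr Q v w"
  using no_loop[OF assms, of v] no_two_cycle_disj[OF assms, of v w]
  by (auto simp: mutate_def cancel_two_cycles_def reverse_at_def add_paths_def)

lemma arr_mutate_other:
  assumes "u \<noteq> v" "w \<noteq> v"
  shows "arr (mutate v Q) u w =
    (arr Q u w + arr Q u v * arr Q v w) - (arr Q w u + arr Q w v * arr Q v u)"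
  using assms by (simp add: mutate_def cancel_two_cycles_def reverse_at_def add_paths_def)

lemma cluster_quiver_mutate:
  assumes Q: "cluster_quiver Q"
  shows "cluster_quiver (mutate v Q)"
  unfolding cluster_quiver_def
proof (intro conjI allI impI)
  show "finite (verts (mutate v Q))" using Q by (simp add: cluster_quiver_finite)
  show "arr (mutate v Q) i i = 0" for i
    using no_loop[OF Q] by (cases "i = v") (simp_all add: arr_mutate_pivot[OF Q] arr_mutate_other)
  show "\<not> (arr (mutate v Q) i j > 0 \<and> arr (mutate v Q) j i > 0)" for i j
    by (simp add: mutate_def cancel_two_cycles_def)
  fix i j assume ij: "arr (mutate v Q) i j > 0"
  consider "i = v" | "j = v" | "i \<noteq> v" "j \<noteq> v" by blast
  then have "i \<in> verts Q \<and> j \<in> verts Q"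
  proof cases
    case 3
    then have "arr Q i j + arr Q i v * arr Q v j > 0" using ij arr_mutate_other[OF 3, of Q] by linarith
    then have "arr Q i j > 0 \<or> arr Q i v > 0 \<and> arr Q v j > 0" by auto
    then show ?thesis using cluster_quiver_verts[OF Q] by blast
  qed (use ij cluster_quiver_verts[OF Q] in \<open>auto simp: arr_mutate_pivot[OF Q]\<close>)
  then show "i \<in> verts (mutate v Q)" "j \<in> verts (mutate v Q)" by simp_all
qed

text \<open>The signed number of arrows between two vertices other than \<open>v\<close> changes by the difference of
  the numbers of paths through \<open>v\<close> in the two directions. Reversing the arrows at \<open>v\<close> negates
  that difference, so a second mutation undoes the change.\<close>

lemma mutate_mutate:
  fixes Q :: "'v quiver"
  assumes Q: "cluster_quiver Q"
  shows "mutate v (mutate v Q) = Q"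
proof -
  let ?Q = "mutate v Q"
  note Q' = cluster_quiver_mutate[OF Q, of v]
  have "arr (mutate v ?Q) u w = arr Q u w" for u w
  proof -
    consider "u = v" | "w = v" | "u \<noteq> v" "w \<noteq> v" by blast
    then show ?thesis
    proof cases
      case 3
      define p where "p = arr Q u v * arr Q v w"
      define q where "q = arr Q w v * arr Q v u"
      have "p = 0 \<or> q = 0"
        using no_two_cycle_disj[OF Q, of u v] by (auto simp: p_def q_def)
      moreover have "arr Q u w = 0 \<or> arr Q w u = 0" by (rule no_two_cycle_disj[OF Q])
      moreover have "arr (mutate v ?Q) u w =
          ((arr Q u w + p - (arr Q w u + q)) + q) - ((arr Q w u + q - (arr Q u w + p)) + p)"
        using 3 by (simp add: arr_mutate_other arr_mutate_pivot[OF Q] p_def q_def mult.commute)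
      ultimately show ?thesis by linarith
    qed (simp_all add: arr_mutate_pivot[OF Q] arr_mutate_pivot[OF Q'])
  qed
  then have "arr (mutate v ?Q) = arr Q" by (intro ext)
  then show ?thesis by (simp add: quiver.equality)
qed

text \<open>The last condition makes three edges at a point an oriented 3-cycle: from \<open>i \<rightarrow> j\<close> it yields
  \<open>j \<rightarrow> k\<close>, and from this \<open>k \<rightarrow> i\<close>. It also bounds the number of edges at a point by three, as the
  arrows between four vertices cannot be directed such that every three of them form an oriented
  cycle.\<close>

definition tree_model :: "'v quiver \<Rightarrow> ('v \<Rightarrow> 'p set) \<Rightarrow> bool" where
  "tree_model Q e \<longleftrightarrow>
     forest (verts Q) e \<and>
     (\<forall>i \<in> verts Q. \<forall>j \<in> verts Q. i \<noteq> j \<longrightarrow>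
        arr Q i j + arr Q j i = (if e i \<inter> e j = {} then 0 else 1)) \<and>
     (\<forall>i \<in> verts Q. \<forall>j \<in> verts Q. \<forall>k \<in> verts Q. i \<noteq> j \<longrightarrow> i \<noteq> k \<longrightarrow> j \<noteq> k \<longrightarrow>
        e i \<inter> e j \<inter> e k \<noteq> {} \<longrightarrow> arr Q i j > 0 \<longrightarrow> arr Q j k > 0)"

locale quiver_with_tree =
  fixes Q :: "'v quiver" and e :: "'v \<Rightarrow> 'p set"
  assumes quiver: "cluster_quiver Q" and model: "tree_model Q e"
begin

lemma forest_verts: "forest (verts Q) e"
  using model by (simp add: tree_model_def)

lemma arr_sum:
  "i \<in> verts Q \<Longrightarrow> j \<in> verts Q \<Longrightarrow> i \<noteq> j \<Longrightarrow> arr Q i j + arr Q j i = (if e i \<inter> e j = {} then 0 else 1)"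
  using model by (simp add: tree_model_def)

lemma cyclic:
  "i \<in> verts Q \<Longrightarrow> j \<in> verts Q \<Longrightarrow> k \<in> verts Q \<Longrightarrow> i \<noteq> k \<Longrightarrow> j \<noteq> k \<Longrightarrow>
     x \<in> e i \<Longrightarrow> x \<in> e j \<Longrightarrow> x \<in> e k \<Longrightarrow> arr Q i j > 0 \<Longrightarrow> arr Q j k > 0"
  using model no_loop[OF quiver, of i] unfolding tree_model_def by (cases "i = j") (auto, blast)

lemma arr_meets: "arr Q i j > 0 \<Longrightarrow> e i \<inter> e j \<noteq> {}"
  using arr_sum[of i j] cluster_quiver_verts[OF quiver, of i j] no_loop[OF quiver, of i]
  by (cases "i = j") auto

lemma arr_le_1: "arr Q i j \<le> 1"
proof (cases "arr Q i j > 0")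
  case True
  then have "i \<in> verts Q" "j \<in> verts Q" "i \<noteq> j"
    using cluster_quiver_verts[OF quiver] no_loop[OF quiver] by auto
  then show ?thesis using arr_sum[of i j] by (simp split: if_splits)
qed simp

lemma meets_arr:
  "i \<in> verts Q \<Longrightarrow> j \<in> verts Q \<Longrightarrow> i \<noteq> j \<Longrightarrow> e i \<inter> e j \<noteq> {} \<Longrightarrow> arr Q i j > 0 \<or> arr Q j i > 0"
  using arr_sum[of i j] by auto

lemma common_point:
  assumes "i \<in> verts Q" "j \<in> verts Q" "k \<in> verts Q" "i \<noteq> j" "i \<noteq> k" "j \<noteq> k"
    and "e i \<inter> e j \<noteq> {}" "e i \<inter> e k \<noteq> {}" "e j \<inter> e k \<noteq> {}"
  obtains x where "x \<in> e i" "x \<in> e j" "x \<in> e k"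
proof -
  obtain x y z where "x \<in> e i" "x \<in> e j" "y \<in> e i" "y \<in> e k" "z \<in> e j" "z \<in> e k"
    using assms(7-9) by blast
  moreover from this have "x = y" using assms(1-6)
    by (intro forest_no_triangle[OF forest_verts, of i j k x y z])
  ultimately show ?thesis using that by blast
qed

text \<open>Two arrows into \<open>v\<close> from edges at the same point would lie in one oriented triangle with \<open>v\<close>.
  Hence at each end of \<open>e v\<close> there is at most one incoming and, by \<open>out_unique\<close>, at most one
  outgoing neighbour of \<open>v\<close>.\<close>

lemma in_unique:
  assumes "v \<in> verts Q" "p \<in> e v" "arr Q i v > 0" "p \<in> e i" "arr Q j v > 0" "p \<in> e j"
  shows "i = j"
proof (rule ccontr)
  assume "i \<noteq> j"
  have "i \<in> verts Q" "j \<in> verts Q" "v \<noteq> j"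
    using assms(3,5) cluster_quiver_verts[OF quiver] no_loop[OF quiver] by auto
  then have "arr Q v j > 0" using cyclic[of i v j p] assms \<open>i \<noteq> j\<close> by blast
  then show False using no_two_cycle[OF quiver] assms(5) by fastforce
qed

lemma out_unique:
  assumes "v \<in> verts Q" "p \<in> e v" "arr Q v i > 0" "p \<in> e i" "arr Q v j > 0" "p \<in> e j"
  shows "i = j"
proof (rule ccontr)
  assume ij: "i \<noteq> j"
  have ne: "i \<in> verts Q" "j \<in> verts Q" "v \<noteq> i" "v \<noteq> j"
    using assms(3,5) cluster_quiver_verts[OF quiver] no_loop[OF quiver] by auto
  have "arr Q i j > 0" using cyclic[of v i j p] assms ne ij by blast
  moreover have "arr Q j i > 0" using cyclic[of v j i p] assms ne ij by blast
  ultimately show False using no_two_cycle[OF quiver] by fastforce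
qed

end

locale quiver_with_pivot = quiver_with_tree Q e for Q :: "'v quiver" and e :: "'v \<Rightarrow> 'p set" +
  fixes v :: 'v and a b :: 'p
  assumes v: "v \<in> verts Q" and ev: "e v = {a, b}"
begin

text \<open>The tree model of the mutated quiver: edges with an arrow into \<open>v\<close> slide along \<open>e v\<close>. On the
  side of the group this is the passage from \<open>t\<^sub>j\<close> to \<open>t\<^sub>v t\<^sub>j t\<^sub>v\<close>.\<close>

definition mutated_edge :: "'v \<Rightarrow> 'p set" where
  "mutated_edge j = (if arr Q j v > 0 then transpose a b ` e j else e j)"

lemma ab: "a \<noteq> b"
  using forest_verts v ev by (rule forest_endsD)

lemma mutated_pivot: "mutated_edge v = {a, b}"
  using no_loop[OF quiver, of v] by (simp add: mutated_edge_def ev)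

lemma neighbour_edge:
  assumes k: "arr Q k v > 0 \<or> arr Q v k > 0"
  obtains p q c where "{p, q} = {a, b}" "p \<noteq> q" "e k = {p, c}" "c \<noteq> p" "c \<noteq> q"
    "transpose a b ` e k = {q, c}"
proof -
  have kv: "k \<in> verts Q" "k \<noteq> v"
    using k cluster_quiver_verts[OF quiver] no_loop[OF quiver] by auto
  have "e k \<inter> e v \<noteq> {}" using k arr_meets[of k v] arr_meets[of v k] by auto
  then obtain p where p: "p \<in> e k" "p \<in> {a, b}" using ev by blast
  define q where "q = (if p = a then b else a)"
  have pq: "{p, q} = {a, b}" "p \<noteq> q" using p ab by (auto simp: q_def)
  obtain c where c: "e k = {p, c}" "p \<noteq> c" using forest_verts kv(1) p(1) by (rule forest_ends)
  have "c \<noteq> q"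
  proof
    assume "c = q"
    then have "p = q"
      using forest_share_unique[OF forest_verts v kv(1), of p q] c p pq ev kv(2) by auto
    then show False using pq by simp
  qed
  moreover have "transpose a b ` e k = {q, c}"
    using c pq \<open>c \<noteq> q\<close> by (auto simp: transpose_def doubleton_eq_iff)
  ultimately show ?thesis using that pq c by blast
qed

lemma non_neighbour:
  assumes "k \<in> verts Q" "k \<noteq> v" "arr Q k v = 0" "arr Q v k = 0"
  shows "a \<notin> e k" "b \<notin> e k" "mutated_edge k = e k" "transpose a b ` e k = e k"
proof -
  have "e k \<inter> e v = {}" using arr_sum[OF assms(1) v assms(2)] assms(3,4) by (simp split: if_splits)
  then show "a \<notin> e k" "b \<notin> e k" using ev by auto
  then show "transpose a b ` e k = e k" by (intro transpose_image_eq) blast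
  show "mutated_edge k = e k" using assms by (simp add: mutated_edge_def)
qed

text \<open>For the edge that slides away from \<open>p\<close>, if there is one, this is its cut on the side away from
  \<open>e v\<close>; otherwise it is the empty set. It is what has to be moved to the other side of the cut
  of \<open>v\<close> when that edge is moved.\<close>

lemma in_cut:
  assumes p: "p \<in> e v"
  obtains X where "a \<notin> X" "b \<notin> X"
    "\<And>k. k \<in> verts Q \<Longrightarrow> separates X (e k) \<longleftrightarrow> arr Q k v > 0 \<and> p \<in> e k"
proof (cases "\<exists>j. arr Q j v > 0 \<and> p \<in> e j")
  case True
  then obtain j where j: "arr Q j v > 0" "p \<in> e j" by blast
  have jv: "j \<in> verts Q" "v \<noteq> j"
    using j cluster_quiver_verts[OF quiver] no_loop[OF quiver] by auto
  obtain S where "is_cut (verts Q) e j S" using forest_verts jv(1) by (rule forest_cut)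
  then obtain X where X: "is_cut (verts Q) e j X" "a \<notin> X"
    using is_cut_Compl[of "verts Q" e j S] by (cases "a \<in> S") auto
  have "b \<notin> X" using is_cut_same_side[OF X(1) v jv(2), of a b] X(2) ev by simp
  moreover have "separates X (e k) \<longleftrightarrow> arr Q k v > 0 \<and> p \<in> e k" if "k \<in> verts Q" for k
  proof -
    have "separates X (e k) \<longleftrightarrow> k = j" using X(1) that by (simp add: is_cut_def)
    then show ?thesis using j in_unique[OF v p j, of k] by blast
  qed
  ultimately show ?thesis using that X(2) by blast
next
  case False
  then show ?thesis using that[of "{}"] by (auto simp: separates_def)
qed

text \<open>For \<open>i \<noteq> v\<close> a cut of \<open>e i\<close> has both ends of \<open>e v\<close> on one side and stays a cut. For \<open>v\<close> itself,
  the branch \<open>X\<close> beyond the edge that leaves \<open>a\<close> and the branch \<open>Y\<close> beyond the edge that leaves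
  \<open>b\<close> change sides.\<close>

lemma forest_mutated: "forest (verts Q) mutated_edge"
  unfolding forest_def
proof (intro conjI ballI)
  show "finite (verts Q)" using quiver by (rule cluster_quiver_finite)
  fix i assume i: "i \<in> verts Q"
  show "card (mutated_edge i) = 2"
    using forest_verts i by (simp add: mutated_edge_def card_image forest_def)
  show "\<exists>S. is_cut (verts Q) mutated_edge i S"
  proof (cases "i = v")
    case False
    obtain S where S: "is_cut (verts Q) e i S" using forest_verts i by (rule forest_cut)
    have "a \<in> S \<longleftrightarrow> b \<in> S" using is_cut_same_side[OF S v] False ev by auto
    then have "transpose a b x \<in> S \<longleftrightarrow> x \<in> S" for x by (simp add: transpose_def)
    then have "separates S (mutated_edge k) \<longleftrightarrow> separates S (e k)" for k
      by (auto simp: mutated_edge_def separates_def)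
    then show ?thesis using S unfolding is_cut_def by blast
  next
    case True
    obtain S0 where "is_cut (verts Q) e v S0" using forest_verts v by (rule forest_cut)
    then obtain S where S: "is_cut (verts Q) e v S" "a \<in> S"
      using is_cut_Compl[of "verts Q" e v S0] by (cases "a \<in> S0") auto
    have bS: "b \<notin> S" using is_cut_ends[OF S(1) v ev] S(2) by blast
    obtain X where X: "a \<notin> X" "b \<notin> X"
      "\<And>k. k \<in> verts Q \<Longrightarrow> separates X (e k) \<longleftrightarrow> arr Q k v > 0 \<and> a \<in> e k"
      using in_cut[of a] ev by auto
    obtain Y where Y: "a \<notin> Y" "b \<notin> Y"
      "\<And>k. k \<in> verts Q \<Longrightarrow> separates Y (e k) \<longleftrightarrow> arr Q k v > 0 \<and> b \<in> e k"
      using in_cut[of b] ev by auto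
    let ?S = "(S - X) \<union> Y"
    have "separates ?S (mutated_edge k) \<longleftrightarrow> k = v" if k: "k \<in> verts Q" for k
    proof (cases "k = v")
      case True
      then show ?thesis using mutated_pivot S(2) bS X Y by (simp add: separates_pair)
    next
      case kv: False
      show ?thesis
      proof (cases "arr Q k v > 0")
        case False
        then have "mutated_edge k = e k" by (simp add: mutated_edge_def)
        moreover have "\<not> separates X (e k)" "\<not> separates Y (e k)" "\<not> separates S (e k)"
          using X(3)[OF k] Y(3)[OF k] False S(1) k kv by (auto simp: is_cut_def)
        ultimately show ?thesis using kv by (auto simp: separates_def)
      next
        case True
        then obtain p q c where pq: "{p, q} = {a, b}" "p \<noteq> q" and c: "e k = {p, c}" "c \<noteq> p" "c \<noteq> q"
          and img: "transpose a b ` e k = {q, c}"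
          by (rule neighbour_edge[OF disjI1])
        have m: "mutated_edge k = {q, c}" using True img by (simp add: mutated_edge_def)
        have cS: "c \<in> S \<longleftrightarrow> p \<in> S" using is_cut_same_side[OF S(1) k kv] c by simp
        have cX: "c \<in> X \<longleftrightarrow> p = a" and cY: "c \<in> Y \<longleftrightarrow> p = b"
          using X(3)[OF k] Y(3)[OF k] True c pq X(1,2) Y(1,2)
          by (auto simp: separates_pair doubleton_eq_iff)
        show ?thesis using pq m cS cX cY kv S(2) bS X(1,2) Y(1,2) ab
          by (auto simp: separates_pair doubleton_eq_iff)
      qed
    qed
    then show ?thesis using True unfolding is_cut_def by blast
  qed
qed

text \<open>A path \<open>i \<rightarrow> v \<rightarrow> j\<close> either closes to a triangle at one end of \<open>e v\<close>, or its edges lie at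
  different ends of \<open>e v\<close>. Mutation deletes the arrow \<open>j \<rightarrow> i\<close> in the first case and creates
  \<open>i \<rightarrow> j\<close> in the second, and sliding \<open>e i\<close> separates or joins the edges accordingly.\<close>

lemma in_out:
  assumes i: "arr Q i v > 0" and j: "arr Q v j > 0"
  shows "arr Q i j = 0" "mutated_edge i \<inter> mutated_edge j = {} \<longleftrightarrow> e i \<inter> e j \<noteq> {}"
    "p \<in> e v \<Longrightarrow> p \<in> e i \<Longrightarrow> p \<notin> e j \<Longrightarrow> e i \<inter> e j = {}"
proof -
  have verts: "i \<in> verts Q" "j \<in> verts Q" "i \<noteq> v" "j \<noteq> v"
    using i j cluster_quiver_verts[OF quiver] no_loop[OF quiver] by auto
  have ij: "i \<noteq> j" using i j no_two_cycle[OF quiver] by fastforce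
  have jv: "arr Q j v = 0" using j no_two_cycle[OF quiver] by blast
  show "arr Q i j = 0"
  proof (rule ccontr)
    assume ne: "arr Q i j \<noteq> 0"
    then obtain x where "x \<in> e i" "x \<in> e j" "x \<in> e v"
      using common_point[of i j v] verts v ij arr_meets i j
      by (metis Int_commute gr0I)
    then have "arr Q j v > 0" using cyclic[of i j v x] verts v ne by simp
    then show False using jv by simp
  qed
  obtain p q c where pq: "{p, q} = {a, b}" "p \<noteq> q" and c: "e i = {p, c}" "c \<noteq> p" "c \<noteq> q"
    and img: "transpose a b ` e i = {q, c}"
    by (rule neighbour_edge[OF disjI1[OF i]])
  obtain r s d where rs: "{r, s} = {a, b}" "r \<noteq> s" and d: "e j = {r, d}" "d \<noteq> r" "d \<noteq> s"
    by (rule neighbour_edge[OF disjI2[OF j]])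
  have mi: "mutated_edge i = {q, c}" using i img by (simp add: mutated_edge_def)
  have mj: "mutated_edge j = e j" using jv by (simp add: mutated_edge_def)
  have share: "p = r \<and> x = p" if x: "x \<in> e i" "x \<in> e j" for x
  proof -
    have "p \<in> e v" using pq(1)[symmetric] by (simp add: ev)
    moreover have "r \<in> e v" using rs(1)[symmetric] by (simp add: ev)
    moreover have "p \<in> e i" "r \<in> e j" using c(1) d(1) by simp_all
    ultimately have pr: "p = r"
      using x by (intro forest_no_triangle[OF forest_verts v verts(1,2) verts(3)[symmetric]
          verts(4)[symmetric], of p r x])
    then have "x = p"
      using forest_share_unique[OF forest_verts verts(1,2) ij x] \<open>p \<in> e i\<close> \<open>r \<in> e j\<close> by simp
    then show ?thesis using pr by blast
  qed
  then have pr: "e i \<inter> e j \<noteq> {} \<longleftrightarrow> p = r" using c d by auto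
  have "c = d \<Longrightarrow> False" using share[of c] c d by auto
  then show "mutated_edge i \<inter> mutated_edge j = {} \<longleftrightarrow> e i \<inter> e j \<noteq> {}"
    unfolding pr mi mj using pq rs c d by (auto simp: doubleton_eq_iff)
  show "e i \<inter> e j = {}" if "p' \<in> e v" "p' \<in> e i" "p' \<notin> e j" for p'
    using pr that c d pq ev by auto
qed

lemma arr_sum_mutated:
  assumes ij: "i \<in> verts Q" "j \<in> verts Q" "i \<noteq> j"
  shows "arr (mutate v Q) i j + arr (mutate v Q) j i =
    (if mutated_edge i \<inter> mutated_edge j = {} then 0 else 1)"
proof -
  have img: "transpose a b ` A \<inter> transpose a b ` B = {} \<longleftrightarrow> A \<inter> B = {}" for A B :: "'p set"
    by (metis image_Int image_is_empty inj_transpose)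
  have img_v: "transpose a b ` e v = e v" using ev by (intro transpose_image_eq) auto
  have pivot: "mutated_edge v \<inter> mutated_edge k = {} \<longleftrightarrow> e v \<inter> e k = {}" for k
    using img[of "e v" "e k"] img_v no_loop[OF quiver, of v] by (simp add: mutated_edge_def)
  have mixed: "arr (mutate v Q) i j + arr (mutate v Q) j i =
      (if mutated_edge i \<inter> mutated_edge j = {} then 0 else 1)"
    if ij: "i \<in> verts Q" "j \<in> verts Q" "i \<noteq> j" "i \<noteq> v" "j \<noteq> v"
    and i: "arr Q i v > 0" and j: "arr Q j v = 0" for i j
  proof (cases "arr Q v j > 0")
    case True
    have "arr Q i v = 1" "arr Q v j = 1" using i True arr_le_1[of i v] arr_le_1[of v j] by simp_all
    then show ?thesis
      using arr_sum[OF ij(1-3)] in_out[OF i True] j ij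
      by (simp add: arr_mutate_other split: if_splits)
  next
    case False
    then have "arr Q v j = 0" by simp
    then have "mutated_edge i \<inter> mutated_edge j = {} \<longleftrightarrow> e i \<inter> e j = {}"
      using non_neighbour[of j] ij j img[of "e i" "e j"] by (simp add: mutated_edge_def)
    then show ?thesis using arr_sum[OF ij(1-3)] no_two_cycle_disj[OF quiver, of i j] ij j False
      by (auto simp add: arr_mutate_other split: if_splits)
  qed
  consider "i = v" | "j = v" | "i \<noteq> v" "j \<noteq> v" by blast
  then show ?thesis
  proof cases
    case 1
    then show ?thesis
      using arr_sum[OF ij] pivot[of j] by (simp add: arr_mutate_pivot[OF quiver] add.commute)
  next
    case 2
    then show ?thesis
      using arr_sum[OF ij] pivot[of i]
      by (simp add: arr_mutate_pivot[OF quiver] add.commute Int_commute)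
  next
    case 3
    consider "arr Q i v > 0" "arr Q j v = 0" | "arr Q i v = 0" "arr Q j v > 0"
      | "arr Q i v > 0" "arr Q j v > 0" | "arr Q i v = 0" "arr Q j v = 0" by blast
    then show ?thesis
    proof cases
      case 1
      then show ?thesis using mixed ij 3 by blast
    next
      case 2
      then show ?thesis using mixed[of j i] ij 3 by (simp add: add.commute Int_commute)
    next
      case both: 3
      then have "arr Q v i = 0" "arr Q v j = 0" using no_two_cycle[OF quiver] by blast+
      then show ?thesis
        using arr_sum[OF ij] both 3 img no_two_cycle_disj[OF quiver, of i j]
        by (auto simp: mutated_edge_def arr_mutate_other split: if_splits)
    next
      case 4
      then show ?thesis
        using arr_sum[OF ij] 3 no_two_cycle_disj[OF quiver, of i j]
        by (auto simp: mutated_edge_def arr_mutate_other split: if_splits)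
    qed
  qed
qed

lemma mutated_at_pivot:
  assumes pq: "{p, q} = {a, b}" "p \<noteq> q" and k: "k \<in> verts Q" "p \<in> mutated_edge k"
  shows "k = v \<or> (arr Q k v > 0 \<and> q \<in> e k \<and> p \<notin> e k) \<or> (arr Q v k > 0 \<and> p \<in> e k)"
proof (cases "k = v \<or> arr Q k v > 0")
  case True
  show ?thesis
  proof (cases "k = v")
    case False
    then have kv: "arr Q k v > 0" using True by simp
    obtain r s c where rs: "{r, s} = {a, b}" "r \<noteq> s" and c: "e k = {r, c}" "c \<noteq> r" "c \<noteq> s"
      and img: "transpose a b ` e k = {s, c}"
      by (rule neighbour_edge[OF disjI1[OF kv]])
    then have "p = s \<or> p = c" using k(2) kv by (simp add: mutated_edge_def)
    then have "p = s" using pq rs c by (auto simp: doubleton_eq_iff)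
    then show ?thesis using kv c pq rs by (auto simp: doubleton_eq_iff)
  qed simp
next
  case False
  then have pk: "p \<in> e k" using k(2) by (simp add: mutated_edge_def)
  moreover have "p \<in> e v" using pq ev by auto
  ultimately show ?thesis using meets_arr[OF k(1) v] False by auto
qed

text \<open>At a point other than the ends of \<open>e v\<close> the same edges meet as before, and the arrows between
  them are the same, for otherwise two of these edges would form a triangle with \<open>e v\<close>. At an
  end \<open>x\<close> of \<open>e v\<close> the only possible edges are now those of \<open>v\<close>, of the vertex with an arrow
  into \<open>v\<close> from the other end, and of the vertex with an arrow from \<open>v\<close> at \<open>x\<close> itself. Their
  arrows form an oriented 3-cycle.\<close>

lemma cyclic_mutated:
  assumes ijk: "i \<in> verts Q" "j \<in> verts Q" "k \<in> verts Q" "i \<noteq> j" "i \<noteq> k" "j \<noteq> k"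
    and x: "x \<in> mutated_edge i" "x \<in> mutated_edge j" "x \<in> mutated_edge k"
    and arr: "arr (mutate v Q) i j > 0"
  shows "arr (mutate v Q) j k > 0"
proof (cases "x \<in> {a, b}")
  case False
  have unmoved: "x \<in> e y \<and> y \<noteq> v" if "x \<in> mutated_edge y" for y
    using that False mutated_pivot
    by (auto simp: mutated_edge_def in_transpose_image_iff split: if_splits)
  have same: "arr (mutate v Q) y z = arr Q y z"
    if y: "y \<in> verts Q" "x \<in> mutated_edge y" and z: "z \<in> verts Q" "x \<in> mutated_edge z"
      and yz: "y \<noteq> z" for y z
  proof -
    have no_path: "arr Q y v * arr Q v z = 0"
      if y: "y \<in> verts Q" "x \<in> mutated_edge y" and z: "z \<in> verts Q" "x \<in> mutated_edge z"
        and yz: "y \<noteq> z" for y z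
    proof (rule ccontr)
      assume "arr Q y v * arr Q v z \<noteq> 0"
      then have "e y \<inter> e v \<noteq> {}" "e v \<inter> e z \<noteq> {}" using arr_meets by (metis gr0I mult_is_0)+
      then obtain p q where pq: "p \<in> e y" "p \<in> e v" "q \<in> e z" "q \<in> e v" by blast
      then have "x = p"
        using forest_no_triangle[OF forest_verts y(1) z(1) v yz, of x p q] unmoved[OF y(2)] unmoved[OF z(2)]
        by blast
      then show False using False pq ev by simp
    qed
    show ?thesis
      using no_path[OF y z yz] no_path[OF z y] yz unmoved[OF y(2)] unmoved[OF z(2)]
        no_two_cycle_disj[OF quiver, of y z]
      by (auto simp: arr_mutate_other)
  qed
  have "arr Q i j > 0" using arr same[of i j] ijk x by simp
  then have "arr Q j k > 0" using cyclic[of i j k x] ijk unmoved x by blast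
  then show ?thesis using same[of j k] ijk x by simp
next
  case True
  define q where "q = (if x = a then b else a)"
  have xq: "{x, q} = {a, b}" "x \<noteq> q" using True ab by (auto simp: q_def)
  then have xv: "x \<in> e v" "q \<in> e v" using ev by auto
  \<comment> \<open>The vertices whose edges have slid to \<open>x\<close> and those whose edges have stayed at \<open>x\<close>.\<close>
  define inn where "inn y \<longleftrightarrow> arr Q y v > 0 \<and> q \<in> e y \<and> x \<notin> e y" for y
  define out where "out y \<longleftrightarrow> arr Q v y > 0 \<and> x \<in> e y" for y
  have kinds: "y = v \<or> inn y \<or> out y" if "y \<in> verts Q" "x \<in> mutated_edge y" for y
    using mutated_at_pivot[OF xq that] by (simp add: inn_def out_def)
  have inn1: "y = z" if "inn y" "inn z" for y z
    using that in_unique[OF v xv(2)] by (auto simp: inn_def)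
  have out1: "y = z" if "out y" "out z" for y z
    using that out_unique[OF v xv(1)] by (auto simp: out_def)
  have not_v: "y \<noteq> v" if "inn y \<or> out y" for y
    using that no_loop[OF quiver, of v] by (auto simp: inn_def out_def)
  have outv: "arr (mutate v Q) y v > 0" if "out y" for y
    using that by (simp add: out_def arr_mutate_pivot[OF quiver])
  have vinn: "arr (mutate v Q) v y > 0" if "inn y" for y
    using that by (simp add: inn_def arr_mutate_pivot[OF quiver])
  have innout: "arr (mutate v Q) y z > 0" if y: "inn y" and z: "out z" for y z
  proof -
    have yv: "arr Q y v > 0" "q \<in> e y" and vz: "arr Q v z > 0" using y z by (auto simp: inn_def out_def)
    have "q \<notin> e z"
    proof
      assume "q \<in> e z"
      then have "x = q"
        using forest_share_unique[OF forest_verts v, of z x q] z xv not_v[of z]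
          cluster_quiver_verts[OF quiver vz] by (auto simp: out_def)
      then show False using xq by simp
    qed
    then have "e y \<inter> e z = {}" using in_out(3)[OF yv(1) vz xv(2) yv(2)] by blast
    then have "arr Q z y = 0" using arr_meets[of z y] by auto
    moreover have "arr Q z v = 0" using no_two_cycle[OF quiver vz] .
    ultimately show ?thesis using yv(1) vz not_v y z by (simp add: arr_mutate_other)
  qed
  have no2: "\<not> arr (mutate v Q) z y > 0" if "arr (mutate v Q) y z > 0" for y z
    using no_two_cycle[OF cluster_quiver_mutate[OF quiver] that] by simp
  have "i = v \<and> inn j \<and> out k \<or> i = v \<and> out j \<and> inn k \<or> inn i \<and> j = v \<and> out k \<or>
      out i \<and> j = v \<and> inn k \<or> inn i \<and> out j \<and> k = v \<or> out i \<and> inn j \<and> k = v"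
    using kinds[of i] kinds[of j] kinds[of k] ijk x inn1 out1 by metis
  then show ?thesis using arr outv vinn innout no2 by metis
qed

lemma tree_model_mutated: "tree_model (mutate v Q) mutated_edge"
  unfolding tree_model_def
proof (intro conjI ballI impI)
  show "forest (verts (mutate v Q)) mutated_edge" using forest_mutated by simp
next
  fix i j assume "i \<in> verts (mutate v Q)" "j \<in> verts (mutate v Q)" "i \<noteq> j"
  then show "arr (mutate v Q) i j + arr (mutate v Q) j i =
      (if mutated_edge i \<inter> mutated_edge j = {} then 0 else 1)"
    by (intro arr_sum_mutated) simp_all
next
  fix i j k
  assume ijk: "i \<in> verts (mutate v Q)" "j \<in> verts (mutate v Q)" "k \<in> verts (mutate v Q)"
    "i \<noteq> j" "i \<noteq> k" "j \<noteq> k" and arr: "arr (mutate v Q) i j > 0"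
    and "mutated_edge i \<inter> mutated_edge j \<inter> mutated_edge k \<noteq> {}"
  then obtain x where x: "x \<in> mutated_edge i" "x \<in> mutated_edge j" "x \<in> mutated_edge k" by blast
  show "arr (mutate v Q) j k > 0"
    by (rule cyclic_mutated[OF ijk(1-3)[unfolded verts_mutate] ijk(4-6) x arr])
qed

end

lemma tree_model_mutate:
  fixes e :: "'v \<Rightarrow> 'p set"
  assumes "cluster_quiver Q" "tree_model Q e" "v \<in> verts Q"
  obtains e' :: "'v \<Rightarrow> 'p set" where "tree_model (mutate v Q) e'"
proof -
  interpret quiver_with_tree Q e using assms by unfold_locales
  obtain a b where "e v = {a, b}" using forest_verts assms(3) by (rule forest_ends')
  then interpret quiver_with_pivot Q e v a b using assms by unfold_locales
  show ?thesis using that tree_model_mutated by blast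
qed


section \<open>Tree models in type A\<close>

text \<open>The \<open>k\<close>-th vertex of the path becomes the edge from \<open>k\<close> to \<open>k + 1\<close>; the cut is the initial
  segment ending in \<open>k\<close>.\<close>

lemma tree_model_path:
  assumes "orientation_of_A n D"
  obtains e :: "'v \<Rightarrow> nat set" where "tree_model (D :: 'v quiver) e"
proof -
  obtain f where f: "bij_betw f {1..n} (verts D)"
    and arr: "\<And>a b. a \<in> {1..n} \<Longrightarrow> b \<in> {1..n} \<Longrightarrow>
      arr D (f a) (f b) + arr D (f b) (f a) = (if a = b + 1 \<or> b = a + 1 then 1 else 0)"
    using assms unfolding orientation_of_A_def by blast
  define g where "g = inv_into {1..n} f"
  have g: "g v \<in> {1..n}" "f (g v) = v" if "v \<in> verts D" for v
  proof -
    have "v \<in> f ` {1..n}" using that bij_betw_imp_surj_on[OF f] by simp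
    from inv_into_into[OF this] f_inv_into_f[OF this] show "g v \<in> {1..n}" "f (g v) = v"
      unfolding g_def by this
  qed
  have g_inj: "g v = g w \<Longrightarrow> v = w" if "v \<in> verts D" "w \<in> verts D" for v w
    using g(2)[OF that(1)] g(2)[OF that(2)] by metis
  define e where "e v = {g v, g v + 1}" for v
  have "tree_model D e"
    unfolding tree_model_def
  proof (intro conjI ballI impI)
    show "forest (verts D) e"
      unfolding forest_def
    proof (intro conjI ballI)
      show "finite (verts D)" using bij_betw_finite[OF f] by simp
      fix i assume i: "i \<in> verts D"
      show "card (e i) = 2" by (simp add: e_def)
      have "separates {..g i} (e j) \<longleftrightarrow> j = i" if "j \<in> verts D" for j
        using g_inj[OF that i] by (auto simp: e_def separates_pair)
      then show "\<exists>S. is_cut (verts D) e i S" unfolding is_cut_def by blast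
    qed
  next
    fix i j assume ij: "i \<in> verts D" "j \<in> verts D" "i \<noteq> j"
    have "g i \<noteq> g j" using g_inj ij by blast
    then have "e i \<inter> e j = {} \<longleftrightarrow> \<not> (g i = g j + 1 \<or> g j = g i + 1)" by (auto simp: e_def)
    then show "arr D i j + arr D j i = (if e i \<inter> e j = {} then 0 else 1)"
      using arr[of "g i" "g j"] g ij by simp
  next
    fix i j k
    assume ijk: "i \<in> verts D" "j \<in> verts D" "k \<in> verts D" "i \<noteq> j" "i \<noteq> k" "j \<noteq> k"
      "e i \<inter> e j \<inter> e k \<noteq> {}"
    have "g i \<noteq> g j" "g i \<noteq> g k" "g j \<noteq> g k" using g_inj ijk by blast+
    then show "arr D j k > 0" using ijk(7) by (auto simp: e_def)
  qed
  then show ?thesis using that by blast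
qed

text \<open>The model is known at the end \<open>D\<close> of the sequence of mutations and is carried back to \<open>Q\<close>,
  which is possible as mutations are involutions.\<close>

lemma tree_model_mutation_equivalent:
  fixes Q D :: "'v quiver" and e :: "'v \<Rightarrow> 'p set"
  assumes "mutation_equivalent Q D" and "cluster_quiver Q" and "tree_model D e"
  obtains e' :: "'v \<Rightarrow> 'p set" where "tree_model Q e'"
proof -
  have "cluster_quiver Q \<Longrightarrow> \<exists>e' :: 'v \<Rightarrow> 'p set. tree_model Q e'"
    using assms(1) unfolding mutation_equivalent_def
  proof (induction rule: converse_rtranclp_induct)
    case base
    then show ?case using assms(3) by blast
  next
    case (step Q Q')
    obtain v where v: "v \<in> verts Q" and Q': "Q' = mutate v Q" using step.hyps(1) by blast
    have quiver': "cluster_quiver Q'" unfolding Q' by (rule cluster_quiver_mutate[OF step.prems])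
    then obtain e' :: "'v \<Rightarrow> 'p set" where e': "tree_model Q' e'" using step.IH by blast
    have "v \<in> verts Q'" using v Q' by simp
    with quiver' e' obtain e'' :: "'v \<Rightarrow> 'p set" where "tree_model (mutate v Q') e''"
      by (rule tree_model_mutate)
    moreover have "mutate v Q' = Q" unfolding Q' by (rule mutate_mutate[OF step.prems])
    ultimately show ?case by auto
  qed
  then show ?thesis using that assms(2) by blast
qed

lemma tree_model_of_type_A:
  assumes "mutation_type_A n Q"
  obtains e :: "'v \<Rightarrow> nat set" where "tree_model (Q :: 'v quiver) e"
proof -
  obtain D where D: "orientation_of_A n D" "mutation_equivalent Q D" and Q: "cluster_quiver Q"
    using assms unfolding mutation_type_A_def by blast
  obtain e :: "'v \<Rightarrow> nat set" where "tree_model D e" using D(1) by (rule tree_model_path)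
  with D(2) Q show ?thesis using that by (rule tree_model_mutation_equivalent)
qed

text \<open>The trees of the components are made disjoint by pairing each point with the vertex set of its
  component.\<close>

lemma tree_model_components:
  fixes Q :: "'v quiver"
  assumes Q: "cluster_quiver Q"
    and comp: "\<And>C. C \<in> connected_components Q \<Longrightarrow> \<exists>e :: 'v \<Rightarrow> 'p set. tree_model C e"
  obtains e :: "'v \<Rightarrow> ('v set \<times> 'p) set" where "tree_model Q e"
proof -
  define R where
    "R = {(i, j). i \<in> verts Q \<and> j \<in> verts Q \<and> equivclp (\<lambda>x y. arr Q x y > 0) i j}"
  have R: "equiv (verts Q) R"
  proof (rule equivI)
    show "refl_on (verts Q) R" by (auto simp: R_def refl_on_def)
    show "sym R" by (auto simp: R_def sym_def intro: equivclp_sym)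
    show "trans R" by (auto simp: R_def trans_def intro: equivclp_trans)
  qed (auto simp: R_def)
  define cl where "cl v = R `` {v}" for v
  have cl_sub: "cl v \<subseteq> verts Q" for v by (auto simp: cl_def R_def)
  have cl_self: "v \<in> cl v" if "v \<in> verts Q" for v
    unfolding cl_def by (rule equiv_class_self[OF R that])
  have cl_iff: "w \<in> cl v \<longleftrightarrow> cl w = cl v" if "v \<in> verts Q" "w \<in> verts Q" for v w
    using eq_equiv_class_iff[OF R that] by (auto simp: cl_def)
  have model: "\<exists>e :: 'v \<Rightarrow> 'p set. tree_model (full_subquiver Q (cl v)) e" if "v \<in> verts Q" for v
  proof (rule comp)
    have "cl v \<in> verts Q // R" unfolding cl_def using that by (rule quotientI)
    then show "full_subquiver Q (cl v) \<in> connected_components Q"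
      unfolding connected_components_def R_def by blast
  qed
  define F :: "'v set \<Rightarrow> 'v \<Rightarrow> 'p set" where
    "F C = (SOME e. tree_model (full_subquiver Q C) e)" for C
  have F: "tree_model (full_subquiver Q (cl v)) (F (cl v))" if "v \<in> verts Q" for v
    unfolding F_def using model[OF that] by (rule someI_ex)
  have verts_full: "verts (full_subquiver Q C) = C" for C by (simp add: full_subquiver_def)
  have arr_full: "arr (full_subquiver Q C) i j = arr Q i j" if "i \<in> C" "j \<in> C" for C i j
    using that by (simp add: full_subquiver_def)
  have arr_cl: "cl i = cl j" if "arr Q i j > 0" for i j
  proof -
    have "(i, j) \<in> R" using that cluster_quiver_verts[OF Q that] by (auto simp: R_def)
    then show ?thesis unfolding cl_def by (rule equiv_class_eq[OF R])
  qed
  define e where "e v = Pair (cl v) ` F (cl v) v" for v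
  have meet: "e i \<inter> e j = {} \<longleftrightarrow> cl i \<noteq> cl j \<or> F (cl i) i \<inter> F (cl i) j = {}" for i j
  proof (cases "cl i = cl j")
    case True
    then have "e i \<inter> e j = Pair (cl i) ` (F (cl i) i \<inter> F (cl i) j)" by (auto simp: e_def)
    then show ?thesis using True by simp
  qed (auto simp: e_def)
  have "tree_model Q e"
    unfolding tree_model_def
  proof (intro conjI ballI impI)
    show "forest (verts Q) e"
      unfolding forest_def
    proof (intro conjI ballI)
      show "finite (verts Q)" using Q by (rule cluster_quiver_finite)
      fix i assume i: "i \<in> verts Q"
      have forest: "forest (cl i) (F (cl i))"
        using F[OF i] by (simp add: tree_model_def verts_full)
      show "card (e i) = 2"
        using forest cl_self[OF i] by (simp add: e_def card_image inj_on_def forest_def)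
      obtain S where S: "is_cut (cl i) (F (cl i)) i S" using forest cl_self[OF i] by (rule forest_cut)
      have "separates ({cl i} \<times> S) (e j) \<longleftrightarrow> j = i" if j: "j \<in> verts Q" for j
      proof (cases "cl j = cl i")
        case True
        then have "separates ({cl i} \<times> S) (e j) \<longleftrightarrow> separates S (F (cl i) j)"
          by (auto simp: e_def separates_def)
        also have "\<dots> \<longleftrightarrow> j = i" using S True cl_iff[OF i j] by (simp add: is_cut_def)
        finally show ?thesis .
      next
        case False
        then show ?thesis by (auto simp: e_def separates_def)
      qed
      then show "\<exists>S. is_cut (verts Q) e i S" unfolding is_cut_def by blast
    qed
  next
    fix i j assume ij: "i \<in> verts Q" "j \<in> verts Q" "i \<noteq> j"
    show "arr Q i j + arr Q j i = (if e i \<inter> e j = {} then 0 else 1)"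
    proof (cases "cl i = cl j")
      case True
      then have "i \<in> cl i" "j \<in> cl i" using ij cl_self by auto
      then show ?thesis
        using F[OF ij(1)] ij(3) True by (simp add: tree_model_def verts_full arr_full meet)
    next
      case False
      then have "arr Q i j = 0" "arr Q j i = 0" using arr_cl[of i j] arr_cl[of j i] by auto
      then show ?thesis using False by (simp add: meet)
    qed
  next
    fix i j k
    assume ijk: "i \<in> verts Q" "j \<in> verts Q" "k \<in> verts Q" "i \<noteq> j" "i \<noteq> k" "j \<noteq> k"
      and ne: "e i \<inter> e j \<inter> e k \<noteq> {}" and arr: "arr Q i j > 0"
    have cl: "cl j = cl i" "cl k = cl i" and ne': "F (cl i) i \<inter> F (cl i) j \<inter> F (cl i) k \<noteq> {}"
      using ne by (auto simp: e_def)
    have mem: "i \<in> cl i" "j \<in> cl i" "k \<in> cl i" using cl_self ijk(1-3) cl by auto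
    then have "arr (full_subquiver Q (cl i)) j k > 0"
      using F[OF ijk(1)] ijk(4-6) ne' arr arr_full[of i "cl i" j]
      unfolding tree_model_def verts_full by auto
    then show "arr Q j k > 0" using mem by (simp add: arr_full)
  qed
  then show ?thesis using that by blast
qed


section \<open>The cluster group acts on the points\<close>

text \<open>The transposition of the two elements of \<open>A\<close>, written without choosing an order of the
  elements.\<close>

definition edge_swap :: "'p set \<Rightarrow> 'p \<Rightarrow> 'p" where
  "edge_swap A x = (if x \<in> A then the_elem (A - {x}) else x)"

lemma edge_swap_pair:
  assumes "x \<noteq> y"
  shows "edge_swap {x, y} = transpose x y"
proof
  fix z
  have "{x, y} - {x} = {y}" "{x, y} - {y} = {x}" using assms by auto
  then show "edge_swap {x, y} z = transpose x y z" by (auto simp: edge_swap_def transpose_def)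
qed

fun word_perm :: "('v \<Rightarrow> 'p set) \<Rightarrow> 'v generator word \<Rightarrow> 'p \<Rightarrow> 'p" where
  "word_perm e [] = id"
| "word_perm e ((gen_t v, b) # w) = edge_swap (e v) \<circ> word_perm e w"

lemma word_perm_append: "word_perm e (u @ w) = word_perm e u \<circ> word_perm e w"
  by (induction e u rule: word_perm.induct) (simp_all add: comp_assoc)

lemma word_perm_t_word: "word_perm e (t_word is) = foldr (\<lambda>i f. edge_swap (e i) \<circ> f) is id"
  by (induction "is") (simp_all add: t_word_def)

lemma pres_eq_word_perm:
  assumes "pres_eq S R u w"
    and swap: "\<And>v. gen_t v \<in> S \<Longrightarrow> edge_swap (e v) \<circ> edge_swap (e v) = id"
    and rel: "\<And>l r. (l, r) \<in> R \<Longrightarrow> word_perm e l = word_perm e r"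
  shows "word_perm e u = word_perm e w"
  using assms(1)
proof (induction rule: pres_eq.induct)
  case (cancel u w g b)
  obtain v where g: "g = gen_t v" by (cases g)
  then have "word_perm e [(g, b), (g, \<not> b)] = id" using swap cancel by simp
  then have "word_perm e ([(g, b), (g, \<not> b)] @ w) = word_perm e w"
    by (simp only: word_perm_append id_comp)
  then show ?case by (simp only: word_perm_append[of e u])
next
  case (rel u w l r)
  then show ?case using assms(3) by (simp add: word_perm_append)
qed simp_all

text \<open>Both sides fix \<open>x\<close> and permute \<open>p\<close>, \<open>r\<close>, \<open>q\<close> cyclically in this order.\<close>

lemma star_transpositions:
  assumes "distinct [x, p, q, r]"
  shows "transpose x p \<circ> (transpose x q \<circ> (transpose x r \<circ> transpose x p)) =
    transpose x q \<circ> (transpose x r \<circ> (transpose x p \<circ> transpose x q))"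
  using assms by (auto simp: fun_eq_iff transpose_def)

lemma cycle_word_3:
  "cycle_word [i, j, k] 0 = t_word [i, j, k, i]"
  "cycle_word [i, j, k] 1 = t_word [j, k, i, j]"
  "cycle_word [i, j, k] 2 = t_word [k, i, j, k]"
proof -
  have "2 * length [i, j, k] - 2 = 4" "length [i, j, k] = 3" by simp_all
  moreover have "[0..<4] = [0, 1, 2, 3 :: nat]" by (simp add: upt_rec)
  ultimately have "cycle_word [i, j, k] a =
      t_word (map (\<lambda>n. [i, j, k] ! ((a + n) mod 3)) [0, 1, 2, 3])" for a
    by (simp only: cycle_word_def)
  then show "cycle_word [i, j, k] 0 = t_word [i, j, k, i]"
    "cycle_word [i, j, k] 1 = t_word [j, k, i, j]"
    "cycle_word [i, j, k] 2 = t_word [k, i, j, k]"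
    by simp_all
qed

context quiver_with_tree
begin

text \<open>The edges of the cycle other than the first one are linked to each other without the first
  one, so a cut of the first edge has all of them on one side. Hence the second and the last
  edge meet the first one in the same end. They meet each other, which in a chordless cycle
  forces the length to be three.\<close>

lemma chordless_cycle_is_triangle:
  assumes c: "chordless_oriented_cycle Q c"
  obtains i j k x where "c = [i, j, k]" "x \<in> e i" "x \<in> e j" "x \<in> e k"
    "i \<in> verts Q" "j \<in> verts Q" "k \<in> verts Q" "i \<noteq> j" "i \<noteq> k" "j \<noteq> k"
proof -
  define m where "m = length c"
  have m: "3 \<le> m" and dist: "distinct c" and sub: "set c \<subseteq> verts Q"
    and step: "\<And>k. k < m \<Longrightarrow> arr Q (c ! k) (c ! ((k + 1) mod m)) > 0"
    and chord: "\<And>k l. k < m \<Longrightarrow> l < m \<Longrightarrow> l \<noteq> (k + 1) mod m \<Longrightarrow> k \<noteq> (l + 1) mod m \<Longrightarrow>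
      no_arrow Q (c ! k) (c ! l)"
    using c unfolding chordless_oriented_cycle_def m_def Let_def by blast+
  have vert: "c ! k \<in> verts Q" if "k < m" for k using sub that by (auto simp: m_def)
  have neq: "c ! k \<noteq> c ! l" if "k < m" "l < m" "k \<noteq> l" for k l
    using dist that by (simp add: m_def nth_eq_iff_index_eq)
  have "c ! 0 \<in> verts Q" using vert[of 0] m by simp
  with forest_verts obtain S where S: "is_cut (verts Q) e (c ! 0) S" by (rule forest_cut)
  obtain y where y: "y \<in> e (c ! 0)" "y \<in> e (c ! 1)" using arr_meets[OF step[of 0]] m by auto
  have "arr Q (c ! (m - 1)) (c ! 0) > 0" using step[of "m - 1"] m by simp
  then obtain z where z: "z \<in> e (c ! 0)" "z \<in> e (c ! (m - 1))" using arr_meets by blast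
  have same: "w \<in> S \<longleftrightarrow> w' \<in> S"
    if "k + 1 < m" "w \<in> e (c ! (k + 1))" "w' \<in> e (c ! (k + 1))" for k w w'
    using S vert[OF that(1)] neq[of "k + 1" 0] that
    by (intro is_cut_same_side[of "verts Q" e "c ! 0" S "c ! (k + 1)"]) auto
  have side: "\<forall>w \<in> e (c ! (k + 1)). w \<in> S \<longleftrightarrow> y \<in> S" if "k + 1 < m" for k
    using that
  proof (induction k)
    case 0
    show ?case
    proof
      fix w assume "w \<in> e (c ! (0 + 1))"
      then show "w \<in> S \<longleftrightarrow> y \<in> S" using same[OF 0, of w y] y(2) by simp
    qed
  next
    case (Suc k)
    have "arr Q (c ! (k + 1)) (c ! (Suc k + 1)) > 0" using step[of "k + 1"] Suc.prems by simp
    then obtain w' where w': "w' \<in> e (c ! (k + 1))" "w' \<in> e (c ! (Suc k + 1))"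
      using arr_meets by blast
    have "w' \<in> S \<longleftrightarrow> y \<in> S" using Suc.IH Suc.prems w'(1) by simp
    then show ?case using same[OF Suc.prems _ w'(2)] by blast
  qed
  have zS: "z \<in> S \<longleftrightarrow> y \<in> S" using side[of "m - 2"] z m by (simp add: numeral_2_eq_2 Suc_diff_Suc)
  have yz: "y = z"
  proof (rule ccontr)
    assume ne: "y \<noteq> z"
    have c0: "c ! 0 \<in> verts Q" using vert[of 0] m by simp
    obtain y' where "e (c ! 0) = {y, y'}" using forest_verts c0 y(1) by (rule forest_ends)
    then have "e (c ! 0) = {y, z}" using z(1) ne by auto
    then show False using is_cut_ends[OF S c0] zS by blast
  qed
  have m3: "m = 3"
  proof (rule ccontr)
    assume "m \<noteq> 3"
    then have m4: "m \<ge> 4" using m by simp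
    have "no_arrow Q (c ! 1) (c ! (m - 1))" using chord[of 1 "m - 1"] m4 by simp
    moreover have "arr Q (c ! 1) (c ! (m - 1)) > 0 \<or> arr Q (c ! (m - 1)) (c ! 1) > 0"
    proof (rule meets_arr)
      show "c ! 1 \<in> verts Q" "c ! (m - 1) \<in> verts Q" "c ! 1 \<noteq> c ! (m - 1)"
        using vert[of 1] vert[of "m - 1"] neq[of 1 "m - 1"] m4 by simp_all
      show "e (c ! 1) \<inter> e (c ! (m - 1)) \<noteq> {}" using y(2) z(2) yz by blast
    qed
    ultimately show False by (auto simp: no_arrow_def)
  qed
  have "c = [c ! 0, c ! 1, c ! 2]"
    using m3 by (intro nth_equalityI) (auto simp: m_def less_Suc_eq numeral_eq_Suc)
  moreover have "y \<in> e (c ! 0)" "y \<in> e (c ! 1)" "y \<in> e (c ! 2)" using y z yz m3 by auto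
  ultimately show ?thesis
    using that[of "c ! 0" "c ! 1" "c ! 2" y] vert neq m3 by simp
qed

lemma edge_swap_ends:
  assumes "i \<in> verts Q" "e i = {x, y}"
  shows "edge_swap (e i) = transpose x y"
  using edge_swap_pair forest_endsD[OF forest_verts assms] assms(2) by metis

lemma edge_swap_square:
  assumes "i \<in> verts Q"
  shows "edge_swap (e i) \<circ> edge_swap (e i) = id"
proof -
  obtain x y where "e i = {x, y}" using forest_verts assms by (rule forest_ends')
  then show ?thesis using edge_swap_ends[OF assms] by simp
qed

lemma edge_swap_commute:
  assumes ij: "i \<in> verts Q" "j \<in> verts Q" and disj: "e i \<inter> e j = {}"
  shows "edge_swap (e i) \<circ> edge_swap (e j) = edge_swap (e j) \<circ> edge_swap (e i)"
proof -
  obtain x y where i: "e i = {x, y}" using forest_verts ij(1) by (rule forest_ends')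
  obtain z w where j: "e j = {z, w}" using forest_verts ij(2) by (rule forest_ends')
  have "x \<noteq> z" "x \<noteq> w" "y \<noteq> z" "y \<noteq> w" using disj i j by auto
  then show ?thesis
    unfolding edge_swap_ends[OF ij(1) i] edge_swap_ends[OF ij(2) j]
    by (auto simp: fun_eq_iff transpose_def)
qed

lemma edge_swap_braid:
  assumes ij: "i \<in> verts Q" "j \<in> verts Q" "i \<noteq> j" and meet: "e i \<inter> e j \<noteq> {}"
  shows "edge_swap (e i) \<circ> edge_swap (e j) \<circ> edge_swap (e i) =
    edge_swap (e j) \<circ> edge_swap (e i) \<circ> edge_swap (e j)"
proof -
  obtain x where x: "x \<in> e i" "x \<in> e j" using meet by blast
  obtain y where i: "e i = {x, y}" "x \<noteq> y" using forest_verts ij(1) x(1) by (rule forest_ends)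
  obtain z where j: "e j = {x, z}" "x \<noteq> z" using forest_verts ij(2) x(2) by (rule forest_ends)
  have "y \<noteq> z" using forest_share_unique[OF forest_verts ij, of x y] i j by auto
  then show ?thesis
    unfolding edge_swap_ends[OF ij(1) i(1)] edge_swap_ends[OF ij(2) j(1)] using i(2) j(2)
    by (auto simp: fun_eq_iff transpose_def)
qed

lemma edge_swap_star:
  assumes ijk: "i \<in> verts Q" "j \<in> verts Q" "k \<in> verts Q" "i \<noteq> j" "i \<noteq> k" "j \<noteq> k"
    and x: "x \<in> e i" "x \<in> e j" "x \<in> e k"
  shows "edge_swap (e i) \<circ> (edge_swap (e j) \<circ> (edge_swap (e k) \<circ> edge_swap (e i))) =
    edge_swap (e j) \<circ> (edge_swap (e k) \<circ> (edge_swap (e i) \<circ> edge_swap (e j)))"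
proof -
  obtain p where i: "e i = {x, p}" "x \<noteq> p" using forest_verts ijk(1) x(1) by (rule forest_ends)
  obtain q where j: "e j = {x, q}" "x \<noteq> q" using forest_verts ijk(2) x(2) by (rule forest_ends)
  obtain r where k: "e k = {x, r}" "x \<noteq> r" using forest_verts ijk(3) x(3) by (rule forest_ends)
  have "p \<noteq> q" using forest_share_unique[OF forest_verts ijk(1,2,4), of x p] i j by auto
  moreover have "p \<noteq> r" using forest_share_unique[OF forest_verts ijk(1,3,5), of x p] i k by auto
  moreover have "q \<noteq> r" using forest_share_unique[OF forest_verts ijk(2,3,6), of x q] j k by auto
  ultimately show ?thesis
    unfolding edge_swap_ends[OF ijk(1) i(1)] edge_swap_ends[OF ijk(2) j(1)] edge_swap_ends[OF ijk(3) k(1)]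
    using i(2) j(2) k(2) by (intro star_transpositions) auto
qed

text \<open>Any two words of a triangle relation are linked by \<open>edge_swap_star\<close> for the rotations of the
  triangle.\<close>

lemma word_perm_relation:
  assumes "(l, r) \<in> cluster_relations Q"
  shows "word_perm e l = word_perm e r"
proof -
  consider (square) i where "i \<in> verts Q" "l = t_word [i, i]" "r = []"
    | (commute) i j where "i \<in> verts Q" "j \<in> verts Q" "no_arrow Q i j" "l = t_word [i, j]" "r = t_word [j, i]"
    | (braid) i j where "i \<in> verts Q" "j \<in> verts Q" "joined_by_simple_arrow Q i j"
        "l = t_word [i, j, i]" "r = t_word [j, i, j]"
    | (cycle) c a b where "chordless_oriented_cycle Q c" "a < length c" "b < length c"
        "l = cycle_word c a" "r = cycle_word c b"
    using assms unfolding cluster_relations_def by blast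
  then show ?thesis
  proof cases
    case square
    then show ?thesis using edge_swap_square by (simp add: word_perm_t_word)
  next
    case commute
    then have "i = j \<or> e i \<inter> e j = {}" using meets_arr[of i j] by (auto simp: no_arrow_def)
    then show ?thesis using commute edge_swap_commute[of i j] by (auto simp: word_perm_t_word)
  next
    case braid
    then have "i \<noteq> j" using no_loop[OF quiver] by (auto simp: joined_by_simple_arrow_def)
    moreover from this have "e i \<inter> e j \<noteq> {}"
      using braid arr_sum[of i j] by (auto simp: joined_by_simple_arrow_def)
    ultimately show ?thesis using braid edge_swap_braid[of i j] by (simp add: word_perm_t_word comp_assoc)
  next
    case cycle
    obtain i j k x where c: "c = [i, j, k]" and x: "x \<in> e i" "x \<in> e j" "x \<in> e k"
      and v: "i \<in> verts Q" "j \<in> verts Q" "k \<in> verts Q" and ne: "i \<noteq> j" "i \<noteq> k" "j \<noteq> k"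
      using cycle(1) by (rule chordless_cycle_is_triangle)
    have 1: "word_perm e (cycle_word c 1) = word_perm e (cycle_word c 0)"
      using edge_swap_star[OF v ne x] unfolding c cycle_word_3 word_perm_t_word by simp
    have 2: "word_perm e (cycle_word c 2) = word_perm e (cycle_word c 1)"
      using edge_swap_star[OF v(2,3,1) ne(3) ne(1,2)[symmetric] x(2,3,1)]
      unfolding c cycle_word_3 word_perm_t_word by simp
    have "a = 0 \<or> a = 1 \<or> a = 2" "b = 0 \<or> b = 1 \<or> b = 2" using cycle(2,3) c by auto
    then show ?thesis using 1 2 unfolding cycle(4,5) by metis
  qed
qed

end


section \<open>The cluster group as a forest group\<close>

text \<open>The relation of the oriented triangle \<open>a \<rightarrow> b \<rightarrow> c \<rightarrow> a\<close> says, up to a braid relation, that \<open>a\<close>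
  commutes with \<open>b c b\<close>. In this form it no longer depends on the orientation, because
  \<open>b c b = c b c\<close>.\<close>

lemma (in group) star_commute:
  assumes inv: "a \<in> involutions" "b \<in> involutions" "c \<in> involutions"
    and braid: "a \<otimes> b \<otimes> a = b \<otimes> a \<otimes> b"
    and star: "a \<otimes> (b \<otimes> (c \<otimes> a)) = b \<otimes> (c \<otimes> (a \<otimes> b))"
  shows "a \<otimes> (b \<otimes> c \<otimes> b) = b \<otimes> c \<otimes> b \<otimes> a"
proof -
  note car = inv[THEN involutions_carrier]
  have "a \<otimes> (b \<otimes> c \<otimes> b) = a \<otimes> (b \<otimes> (c \<otimes> a)) \<otimes> a \<otimes> b"
    using car inv by (simp add: m_assoc involution_cancel)
  also have "\<dots> = b \<otimes> c \<otimes> (a \<otimes> b \<otimes> a) \<otimes> b" unfolding star using car by (simp add: m_assoc)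
  also have "\<dots> = b \<otimes> c \<otimes> b \<otimes> a" unfolding braid using car inv by (simp add: m_assoc involution_square)
  finally show ?thesis .
qed

context quiver_with_tree
begin

abbreviation word_elem :: "'v generator word \<Rightarrow> 'v generator word set" where
  "word_elem \<equiv> word_class (cluster_generators Q) (cluster_relations Q)"

abbreviation t :: "'v \<Rightarrow> 'v generator word set" where
  "t i \<equiv> gen_elem Q (gen_t i)"

lemma t_word_words: "set is \<subseteq> verts Q \<Longrightarrow> t_word is \<in> words (cluster_generators Q)"
  by (auto simp: t_word_def cluster_generators_def subset_iff)

lemma word_elem_Nil: "word_elem (t_word []) = \<one>\<^bsub>cluster_group Q\<^esub>"
  by (simp add: cluster_group_def presented_group_def t_word_def)

lemma word_elem_Cons:
  assumes "set (i # is) \<subseteq> verts Q"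
  shows "word_elem (t_word (i # is)) = t i \<otimes>\<^bsub>cluster_group Q\<^esub> word_elem (t_word is)"
proof -
  have "t_word [i] \<in> words (cluster_generators Q)" "t_word is \<in> words (cluster_generators Q)"
    using assms by (simp_all add: t_word_words)
  then have "word_elem (t_word [i]) \<otimes>\<^bsub>cluster_group Q\<^esub> word_elem (t_word is) =
      word_elem (t_word [i] @ t_word is)"
    unfolding cluster_group_def by (rule presented_group_mult)
  then show ?thesis by (simp add: t_word_def gen_elem_def)
qed

lemma word_elem_relation:
  assumes "(t_word is, t_word js) \<in> cluster_relations Q" "set is \<subseteq> verts Q" "set js \<subseteq> verts Q"
  shows "word_elem (t_word is) = word_elem (t_word js)"
proof -
  note words = t_word_words[OF assms(2)] t_word_words[OF assms(3)]
  have "pres_eq (cluster_generators Q) (cluster_relations Q) ([] @ t_word is @ []) ([] @ t_word js @ [])"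
    by (rule pres_eq.rel[OF _ _ assms(1) words]) simp_all
  then show ?thesis using word_class_eq_iff[OF words(1)] by simp
qed

text \<open>By \<open>pres_eq_word_perm\<close> the choice of the representing word does not matter.\<close>

definition perm :: "'v generator word set \<Rightarrow> 'p \<Rightarrow> 'p" where
  "perm C = word_perm e (SOME w. w \<in> C)"

lemma perm_word_elem:
  assumes w: "w \<in> words (cluster_generators Q)"
  shows "perm (word_elem w) = word_perm e w"
proof -
  have "w \<in> word_elem w" using w by (simp add: word_class_def pres_eq.refl)
  then have "(SOME w'. w' \<in> word_elem w) \<in> word_elem w" by (rule someI)
  then have "pres_eq (cluster_generators Q) (cluster_relations Q) w (SOME w'. w' \<in> word_elem w)"
    by (simp add: word_class_def)
  then have "word_perm e w = word_perm e (SOME w'. w' \<in> word_elem w)"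
    by (rule pres_eq_word_perm)
      (auto simp: cluster_generators_def edge_swap_square word_perm_relation)
  then show ?thesis by (simp add: perm_def)
qed

lemma t_star_oriented:
  assumes v: "i \<in> verts Q" "j \<in> verts Q" "k \<in> verts Q" and ne: "i \<noteq> j" "i \<noteq> k" "j \<noteq> k"
    and x: "x \<in> e i" "x \<in> e j" "x \<in> e k" and ij: "arr Q i j > 0"
  shows "word_elem (t_word [i, j, k, i]) = word_elem (t_word [j, k, i, j])"
proof -
  have jk: "arr Q j k > 0" using cyclic[OF v(1,2,3) ne(2,3) x ij] .
  have ki: "arr Q k i > 0" using cyclic[OF v(2,3,1) ne(1)[symmetric] ne(2)[symmetric] x(2,3,1) jk] .
  have less3: "n < length [i, j, k] \<Longrightarrow> n = 0 \<or> n = 1 \<or> n = 2" for n by auto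
  have "chordless_oriented_cycle Q [i, j, k]"
    unfolding chordless_oriented_cycle_def Let_def
  proof (intro conjI allI impI)
    show "3 \<le> length [i, j, k]" "distinct [i, j, k]" "set [i, j, k] \<subseteq> verts Q"
      using v ne by simp_all
    show "arr Q ([i, j, k] ! n) ([i, j, k] ! ((n + 1) mod length [i, j, k])) > 0"
      if "n < length [i, j, k]" for n
      using less3[OF that] ij jk ki by (elim disjE) simp_all
    fix n l
    assume nl: "n < length [i, j, k]" "l < length [i, j, k]"
      "l \<noteq> (n + 1) mod length [i, j, k] \<and> n \<noteq> (l + 1) mod length [i, j, k]"
    then have "n = l" using less3[OF nl(1)] less3[OF nl(2)] by (elim disjE) simp_all
    then show "no_arrow Q ([i, j, k] ! n) ([i, j, k] ! l)"
      using no_loop[OF quiver] by (simp add: no_arrow_def)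
  qed
  moreover have "all_arrows_simple Q [i, j, k]"
    unfolding all_arrows_simple_def
  proof (intro allI impI)
    fix n assume n: "n < length [i, j, k]"
    have "joined_by_simple_arrow Q i j" "joined_by_simple_arrow Q j k" "joined_by_simple_arrow Q k i"
      using ij jk ki arr_sum[OF v(1,2) ne(1)] arr_sum[OF v(2,3) ne(3)] arr_sum[OF v(1,3) ne(2)]
      by (simp_all add: joined_by_simple_arrow_def split: if_splits)
    then show "joined_by_simple_arrow Q ([i, j, k] ! n) ([i, j, k] ! ((n + 1) mod length [i, j, k]))"
      using less3[OF n] by (elim disjE) simp_all
  qed
  ultimately have "(cycle_word [i, j, k] 0, cycle_word [i, j, k] 1) \<in> cluster_relations Q"
    unfolding cluster_relations_def
    by (intro UnI2 CollectI exI[of _ "[i, j, k]"] exI[of _ 0] exI[of _ 1]) simp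
  then show ?thesis unfolding cycle_word_3 using v by (intro word_elem_relation) auto
qed

sublocale tree_reflection_group "cluster_group Q" "verts Q" e t perm
proof -
  interpret group "cluster_group Q" by (rule group_cluster_group)
  let ?G = "cluster_group Q"
  have car: "t i \<in> carrier ?G" if "i \<in> verts Q" for i
    using that by (intro gen_elem_in_carrier) (simp add: cluster_generators_def)
  have inv: "t i \<in> involutions" if i: "i \<in> verts Q" for i
  proof -
    have "(t_word [i, i], t_word []) \<in> cluster_relations Q"
      using i by (auto simp: cluster_relations_def t_word_def)
    then have "word_elem (t_word [i, i]) = word_elem (t_word [])"
      using i by (intro word_elem_relation) auto
    then show ?thesis
      using i car[OF i] by (simp add: word_elem_Cons word_elem_Nil involutions_def)
  qed
  have braid: "t i \<otimes>\<^bsub>?G\<^esub> t j \<otimes>\<^bsub>?G\<^esub> t i = t j \<otimes>\<^bsub>?G\<^esub> t i \<otimes>\<^bsub>?G\<^esub> t j"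
    if ij: "i \<in> verts Q" "j \<in> verts Q" "i \<noteq> j" and "e i \<inter> e j \<noteq> {}" for i j
  proof -
    have "joined_by_simple_arrow Q i j"
      using arr_sum[OF ij] that(4) by (simp add: joined_by_simple_arrow_def)
    then have "(t_word [i, j, i], t_word [j, i, j]) \<in> cluster_relations Q"
      using ij by (auto simp: cluster_relations_def)
    then have "word_elem (t_word [i, j, i]) = word_elem (t_word [j, i, j])"
      using ij by (intro word_elem_relation) auto
    then show ?thesis using ij car by (simp add: word_elem_Cons word_elem_Nil m_assoc)
  qed
  have star: "t i \<otimes>\<^bsub>?G\<^esub> (t j \<otimes>\<^bsub>?G\<^esub> t k \<otimes>\<^bsub>?G\<^esub> t j) = t j \<otimes>\<^bsub>?G\<^esub> t k \<otimes>\<^bsub>?G\<^esub> t j \<otimes>\<^bsub>?G\<^esub> t i"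
    if v: "i \<in> verts Q" "j \<in> verts Q" "k \<in> verts Q" and ne: "i \<noteq> j" "i \<noteq> k" "j \<noteq> k"
      and x: "x \<in> e i" "x \<in> e j" "x \<in> e k" and ij: "arr Q i j > 0" for i j k x
    using t_star_oriented[OF v ne x ij] v car braid[OF v(1,2) ne(1)] x
    by (intro star_commute inv) (auto simp: word_elem_Cons word_elem_Nil)
  show "tree_reflection_group ?G (verts Q) e t perm"
  proof
    show "forest (verts Q) e" by (rule forest_verts)
    show "t i \<in> involutions" if "i \<in> verts Q" for i using that by (rule inv)
    show "t i \<otimes>\<^bsub>?G\<^esub> t j = t j \<otimes>\<^bsub>?G\<^esub> t i"
      if ij: "i \<in> verts Q" "j \<in> verts Q" and disj: "e i \<inter> e j = {}" for i j
    proof -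
      have "no_arrow Q i j" using arr_meets[of i j] arr_meets[of j i] disj by (auto simp: no_arrow_def)
      then have "(t_word [i, j], t_word [j, i]) \<in> cluster_relations Q"
        using ij by (auto simp: cluster_relations_def)
      then have "word_elem (t_word [i, j]) = word_elem (t_word [j, i])"
        using ij by (intro word_elem_relation) auto
      then show ?thesis using ij car by (simp add: word_elem_Cons word_elem_Nil)
    qed
    show "t i \<otimes>\<^bsub>?G\<^esub> t j \<otimes>\<^bsub>?G\<^esub> t i = t j \<otimes>\<^bsub>?G\<^esub> t i \<otimes>\<^bsub>?G\<^esub> t j"
      if "i \<in> verts Q" "j \<in> verts Q" "i \<noteq> j" "e i \<inter> e j \<noteq> {}" for i j
      using that by (rule braid)
    show "t i \<otimes>\<^bsub>?G\<^esub> (t j \<otimes>\<^bsub>?G\<^esub> t k \<otimes>\<^bsub>?G\<^esub> t j) = t j \<otimes>\<^bsub>?G\<^esub> t k \<otimes>\<^bsub>?G\<^esub> t j \<otimes>\<^bsub>?G\<^esub> t i"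
      if v: "i \<in> verts Q" "j \<in> verts Q" "k \<in> verts Q" and ne: "i \<noteq> j" "i \<noteq> k" "j \<noteq> k"
        and meet: "e i \<inter> e j \<inter> e k \<noteq> {}" for i j k
    proof -
      obtain x where x: "x \<in> e i" "x \<in> e j" "x \<in> e k" using meet by blast
      consider "arr Q i j > 0" | "arr Q j i > 0"
        using meets_arr[OF v(1,2) ne(1)] x(1,2) by (metis disjoint_iff)
      then show ?thesis
      proof cases
        case 1
        then show ?thesis by (rule star[OF v ne x])
      next
        case 2
        have "arr Q i k > 0" using cyclic[OF v(2,1,3) ne(3,2) x(2,1,3) 2] .
        then have "t i \<otimes>\<^bsub>?G\<^esub> (t k \<otimes>\<^bsub>?G\<^esub> t j \<otimes>\<^bsub>?G\<^esub> t k) = t k \<otimes>\<^bsub>?G\<^esub> t j \<otimes>\<^bsub>?G\<^esub> t k \<otimes>\<^bsub>?G\<^esub> t i"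
          by (rule star[OF v(1,3,2) ne(2,1) ne(3)[symmetric] x(1,3,2)])
        moreover have "t k \<otimes>\<^bsub>?G\<^esub> t j \<otimes>\<^bsub>?G\<^esub> t k = t j \<otimes>\<^bsub>?G\<^esub> t k \<otimes>\<^bsub>?G\<^esub> t j"
          using x by (intro braid[OF v(3,2) ne(3)[symmetric]]) blast
        ultimately show ?thesis by simp
      qed
    qed
    show "perm \<one>\<^bsub>?G\<^esub> = id"
      using perm_word_elem[of "[]"] word_elem_Nil by (simp add: t_word_def)
    show "perm (g \<otimes>\<^bsub>?G\<^esub> h) = perm g \<circ> perm h" if gh: "g \<in> carrier ?G" "h \<in> carrier ?G" for g h
    proof -
      obtain u where u: "u \<in> words (cluster_generators Q)" "g = word_elem u"
        using gh(1) by (auto simp: cluster_group_def presented_group_def)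
      obtain w where w: "w \<in> words (cluster_generators Q)" "h = word_elem w"
        using gh(2) by (auto simp: cluster_group_def presented_group_def)
      have "g \<otimes>\<^bsub>?G\<^esub> h = word_elem (u @ w)"
        unfolding u(2) w(2) cluster_group_def using u(1) w(1) by (rule presented_group_mult)
      then show ?thesis using u w by (simp add: perm_word_elem word_perm_append)
    qed
    show "perm (t i) = transpose x y" if i: "i \<in> verts Q" "e i = {x, y}" for i x y
    proof -
      have "perm (t i) = word_perm e [(gen_t i, True)]"
        unfolding gen_elem_def using i(1) by (intro perm_word_elem) (simp add: cluster_generators_def)
      then show ?thesis using edge_swap_ends[OF i] by simp
    qed
  qed
qed

end


section \<open>Lattices of parabolic subgroups\<close>

context tree_reflection_group
begin

lemma generate_t_mono: "I \<subseteq> J \<Longrightarrow> generate G (t ` I) \<subseteq> generate G (t ` J)"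
  by (intro mono_generate image_mono)

lemma generate_t_Int:
  assumes "I \<subseteq> E" "J \<subseteq> E"
  shows "generate G (t ` I) \<inter> generate G (t ` J) = generate G (t ` (I \<inter> J))"
proof
  show "generate G (t ` (I \<inter> J)) \<subseteq> generate G (t ` I) \<inter> generate G (t ` J)"
    using generate_t_mono[of "I \<inter> J"] by simp
  show "generate G (t ` I) \<inter> generate G (t ` J) \<subseteq> generate G (t ` (I \<inter> J))"
  proof
    fix g assume g: "g \<in> generate G (t ` I) \<inter> generate G (t ` J)"
    then have gE: "g \<in> generate G (t ` E)" using generate_t_mono[OF assms(1)] by blast
    have "preserves_cuts (E - I) (\<phi> g)" "preserves_cuts (E - J) (\<phi> g)"
      using g generated_iff_preserves_cuts[OF _ gE] assms by simp_all
    then have "preserves_cuts (E - I \<inter> J) (\<phi> g)" by (auto simp: preserves_cuts_def)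
    then show "g \<in> generate G (t ` (I \<inter> J))"
      using generated_iff_preserves_cuts[OF _ gE, of "I \<inter> J"] assms by auto
  qed
qed

lemma t_in_generate_iff:
  assumes i: "i \<in> E" and I: "I \<subseteq> E"
  shows "t i \<in> generate G (t ` I) \<longleftrightarrow> i \<in> I"
proof
  assume ti: "t i \<in> generate G (t ` I)"
  show "i \<in> I"
  proof (rule ccontr)
    assume "i \<notin> I"
    obtain a b where ab: "e i = {a, b}" using forest i by (rule forest_ends')
    obtain S where S: "is_cut E e i S" using forest i by (rule forest_cut)
    have "\<phi> (t i) a \<in> S \<longleftrightarrow> a \<in> S"
      using preserves_cuts_generate[OF I ti] i \<open>i \<notin> I\<close> S by (simp add: preserves_cuts_def)
    then have "b \<in> S \<longleftrightarrow> a \<in> S" using perm_t[OF i ab] by simp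
    then show False using is_cut_ends[OF S i ab] by blast
  qed
qed (auto intro: generate.incl)

lemma generate_t_subset_iff:
  assumes "I \<subseteq> E" "J \<subseteq> E"
  shows "generate G (t ` I) \<subseteq> generate G (t ` J) \<longleftrightarrow> I \<subseteq> J"
proof
  assume sub: "generate G (t ` I) \<subseteq> generate G (t ` J)"
  show "I \<subseteq> J"
  proof
    fix i assume "i \<in> I"
    then have "t i \<in> generate G (t ` J)" using sub by (auto intro: generate.incl)
    then show "i \<in> J" using t_in_generate_iff assms \<open>i \<in> I\<close> by blast
  qed
qed (rule generate_t_mono)

end

lemma partial_order_inclusion_order: "partial_order (inclusion_order A)"
  by unfold_locales (auto simp: inclusion_order_def)

lemma inclusion_order_least:
  assumes "a \<in> A" "b \<in> A" "c \<in> A" "a \<subseteq> c" "b \<subseteq> c"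
    and "\<And>d. d \<in> A \<Longrightarrow> a \<subseteq> d \<Longrightarrow> b \<subseteq> d \<Longrightarrow> c \<subseteq> d"
  shows "least (inclusion_order A) c (Upper (inclusion_order A) {a, b})"
  using assms by (auto simp: least_def Upper_def inclusion_order_def)

lemma inclusion_order_greatest:
  assumes "a \<in> A" "b \<in> A" "c \<in> A" "c \<subseteq> a" "c \<subseteq> b"
    and "\<And>d. d \<in> A \<Longrightarrow> d \<subseteq> a \<Longrightarrow> d \<subseteq> b \<Longrightarrow> d \<subseteq> c"
  shows "greatest (inclusion_order A) c (Lower (inclusion_order A) {a, b})"
  using assms by (auto simp: greatest_def Lower_def inclusion_order_def)

lemma inclusion_order_join:
  assumes "least (inclusion_order A) c (Upper (inclusion_order A) {a, b})"
  shows "a \<squnion>\<^bsub>inclusion_order A\<^esub> b = c"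
  unfolding join_def Lattice.sup_def
  using assms partial_order.least_unique[OF partial_order_inclusion_order]
  by (intro some_equality) blast+

lemma inclusion_order_meet:
  assumes "greatest (inclusion_order A) c (Lower (inclusion_order A) {a, b})"
  shows "a \<sqinter>\<^bsub>inclusion_order A\<^esub> b = c"
  unfolding meet_def Lattice.inf_def
  using assms partial_order.greatest_unique[OF partial_order_inclusion_order]
  by (intro some_equality) blast+

lemma lattice_inclusion_order:
  assumes "\<And>a b. a \<in> A \<Longrightarrow> b \<in> A \<Longrightarrow> \<exists>c. least (inclusion_order A) c (Upper (inclusion_order A) {a, b})"
    and "\<And>a b. a \<in> A \<Longrightarrow> b \<in> A \<Longrightarrow> \<exists>c. greatest (inclusion_order A) c (Lower (inclusion_order A) {a, b})"
  shows "lattice (inclusion_order A)"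
proof -
  interpret partial_order "inclusion_order A" by (rule partial_order_inclusion_order)
  have "carrier (inclusion_order A) = A" by (simp add: inclusion_order_def)
  then show ?thesis using assms by unfold_locales blast+
qed

text \<open>An order embedding of a power set is an isomorphism onto its image. The lattice operations of
  the image are determined by its inclusion order, and this is carried over from the power set.\<close>

lemma lattice_isomorphism_Pow:
  assumes emb: "\<And>I J. I \<subseteq> T \<Longrightarrow> J \<subseteq> T \<Longrightarrow> \<Phi> I \<subseteq> \<Phi> J \<longleftrightarrow> I \<subseteq> J"
  shows "lattice_isomorphism (inclusion_order (Pow T)) (inclusion_order (\<Phi> ` Pow T)) \<Phi>"
proof -
  let ?L = "inclusion_order (Pow T)" and ?M = "inclusion_order (\<Phi> ` Pow T)"
  have least_L: "least ?L (I \<union> J) (Upper ?L {I, J})"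
    and greatest_L: "greatest ?L (I \<inter> J) (Lower ?L {I, J})"
    if "I \<subseteq> T" "J \<subseteq> T" for I J
    using that by (auto intro!: inclusion_order_least inclusion_order_greatest)
  have least_M: "least ?M (\<Phi> (I \<union> J)) (Upper ?M {\<Phi> I, \<Phi> J})"
    and greatest_M: "greatest ?M (\<Phi> (I \<inter> J)) (Lower ?M {\<Phi> I, \<Phi> J})"
    if IJ: "I \<subseteq> T" "J \<subseteq> T" for I J
  proof -
    have sub: "I \<union> J \<subseteq> T" "I \<inter> J \<subseteq> T" using IJ by auto
    show "least ?M (\<Phi> (I \<union> J)) (Upper ?M {\<Phi> I, \<Phi> J})"
    proof (rule inclusion_order_least)
      fix d assume "d \<in> \<Phi> ` Pow T" "\<Phi> I \<subseteq> d" "\<Phi> J \<subseteq> d"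
      then obtain K where K: "K \<subseteq> T" "d = \<Phi> K" "\<Phi> I \<subseteq> \<Phi> K" "\<Phi> J \<subseteq> \<Phi> K" by blast
      then have "I \<union> J \<subseteq> K" using emb[of I K] emb[of J K] IJ by simp
      then show "\<Phi> (I \<union> J) \<subseteq> d" using emb[OF sub(1) K(1)] K(2) by simp
    qed (use IJ sub emb[OF IJ(1) sub(1)] emb[OF IJ(2) sub(1)] in auto)
    show "greatest ?M (\<Phi> (I \<inter> J)) (Lower ?M {\<Phi> I, \<Phi> J})"
    proof (rule inclusion_order_greatest)
      fix d assume "d \<in> \<Phi> ` Pow T" "d \<subseteq> \<Phi> I" "d \<subseteq> \<Phi> J"
      then obtain K where K: "K \<subseteq> T" "d = \<Phi> K" "\<Phi> K \<subseteq> \<Phi> I" "\<Phi> K \<subseteq> \<Phi> J" by blast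
      then have "K \<subseteq> I \<inter> J" using emb[of K I] emb[of K J] IJ by simp
      then show "d \<subseteq> \<Phi> (I \<inter> J)" using emb[OF K(1) sub(2)] K(2) by simp
    qed (use IJ sub emb[OF sub(2) IJ(1)] emb[OF sub(2) IJ(2)] in auto)
  qed
  have "lattice ?L" using least_L greatest_L by (intro lattice_inclusion_order) blast+
  moreover have "lattice ?M" using least_M greatest_M by (intro lattice_inclusion_order) blast+
  moreover have "bij_betw \<Phi> (Pow T) (\<Phi> ` Pow T)"
  proof (intro inj_on_imp_bij_betw inj_onI)
    fix I J assume "I \<in> Pow T" "J \<in> Pow T" "\<Phi> I = \<Phi> J"
    then show "I = J" using emb[of I J] emb[of J I] by simp
  qed
  moreover have "carrier ?L = Pow T" "carrier ?M = \<Phi> ` Pow T" by (simp_all add: inclusion_order_def)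
  ultimately show ?thesis
    unfolding lattice_isomorphism_def join_pres_def meet_pres_def
    by (simp add: inclusion_order_join[OF least_L] inclusion_order_join[OF least_M]
        inclusion_order_meet[OF greatest_L] inclusion_order_meet[OF greatest_M])
qed

context quiver_with_tree
begin

lemma parabolic_gen_t: "parabolic Q (gen_t ` J) = generate (cluster_group Q) (t ` J)"
  by (simp add: parabolic_def image_image)

lemma generator_subsetE:
  assumes "I \<subseteq> cluster_generators Q"
  obtains J where "J \<subseteq> verts Q" "I = gen_t ` J"
  using assms unfolding cluster_generators_def by (auto simp: subset_image_iff)

lemma parabolic_subset_iff:
  assumes "I \<subseteq> cluster_generators Q" "J \<subseteq> cluster_generators Q"
  shows "parabolic Q I \<subseteq> parabolic Q J \<longleftrightarrow> I \<subseteq> J"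
proof -
  obtain I' where I': "I' \<subseteq> verts Q" "I = gen_t ` I'" using assms(1) by (rule generator_subsetE)
  obtain J' where J': "J' \<subseteq> verts Q" "J = gen_t ` J'" using assms(2) by (rule generator_subsetE)
  have inj: "inj (gen_t :: 'v \<Rightarrow> 'v generator)" by (simp add: inj_def)
  then show ?thesis
    using generate_t_subset_iff[OF I'(1) J'(1)] unfolding I'(2) J'(2) parabolic_gen_t
    by (simp add: inj_image_subset_iff[OF inj])
qed

lemma parabolic_Int:
  assumes "I \<subseteq> cluster_generators Q" "J \<subseteq> cluster_generators Q"
  shows "parabolic Q I \<inter> parabolic Q J = parabolic Q (I \<inter> J)"
proof -
  obtain I' where I': "I' \<subseteq> verts Q" "I = gen_t ` I'" using assms(1) by (rule generator_subsetE)
  obtain J' where J': "J' \<subseteq> verts Q" "J = gen_t ` J'" using assms(2) by (rule generator_subsetE)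
  have inj: "inj (gen_t :: 'v \<Rightarrow> 'v generator)" by (simp add: inj_def)
  have "I \<inter> J = gen_t ` (I' \<inter> J')"
    unfolding I'(2) J'(2) by (rule image_Int[OF inj, symmetric])
  then show ?thesis
    using generate_t_Int[OF I'(1) J'(1)] unfolding I'(2) J'(2) by (simp only: parabolic_gen_t)
qed

end

lemma subgroup_parabolic:
  assumes "I \<subseteq> cluster_generators Q"
  shows "subgroup (parabolic Q I) (cluster_group Q)"
  unfolding parabolic_def using assms gen_elem_in_carrier
  by (intro group.generate_is_subgroup[OF group_cluster_group]) blast

lemma generate_parabolic_Un:
  assumes I: "I \<subseteq> cluster_generators Q" and J: "J \<subseteq> cluster_generators Q"
  shows "generate (cluster_group Q) (parabolic Q I \<union> parabolic Q J) = parabolic Q (I \<union> J)"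
proof
  interpret group "cluster_group Q" by (rule group_cluster_group)
  show "generate (cluster_group Q) (parabolic Q I \<union> parabolic Q J) \<subseteq> parabolic Q (I \<union> J)"
  proof (rule generate_subgroup_incl)
    show "subgroup (parabolic Q (I \<union> J)) (cluster_group Q)"
      using I J by (intro subgroup_parabolic) simp
    show "parabolic Q I \<union> parabolic Q J \<subseteq> parabolic Q (I \<union> J)"
      unfolding parabolic_def by (intro Un_least mono_generate image_mono) simp_all
  qed
  have "gen_elem Q ` (I \<union> J) \<subseteq> parabolic Q I \<union> parabolic Q J"
    unfolding parabolic_def by (auto intro: generate.incl)
  then show "parabolic Q (I \<union> J) \<subseteq> generate (cluster_group Q) (parabolic Q I \<union> parabolic Q J)"
    unfolding parabolic_def[of Q "I \<union> J"] by (rule mono_generate)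
qed

theorem theorem4p15:
  fixes Q :: "'v quiver"
    and r :: nat
    and Qs :: "nat \<Rightarrow> 'v quiver"
    and n :: "nat \<Rightarrow> nat"
  assumes "cluster_quiver Q"
    and "bij_betw Qs {1..r} (connected_components Q)"
    and "\<And>k. k \<in> {1..r} \<Longrightarrow> n k \<ge> 1"
    and "\<And>k. k \<in> {1..r} \<Longrightarrow> mutation_type_A (n k) (Qs k)"
  shows "sublattice (parabolic_subgroups Q) (subgroup_lattice (cluster_group Q)) \<and>
         lattice_isomorphism (inclusion_order (Pow (cluster_generators Q)))
           (inclusion_order (parabolic_subgroups Q)) (\<lambda>I. parabolic Q I)"
proof -
  have comp: "\<exists>e :: 'v \<Rightarrow> nat set. tree_model C e" if "C \<in> connected_components Q" for C
  proof -
    have "C \<in> Qs ` {1..r}" using that bij_betw_imp_surj_on[OF assms(2)] by simp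
    then obtain k where "k \<in> {1..r}" "C = Qs k" by blast
    then have "mutation_type_A (n k) C" using assms(4) by simp
    then show ?thesis by (rule tree_model_of_type_A) blast
  qed
  obtain e :: "'v \<Rightarrow> ('v set \<times> nat) set" where "tree_model Q e"
    using assms(1) comp by (rule tree_model_components)
  then interpret quiver_with_tree Q e using assms(1) by unfold_locales
  have par: "parabolic_subgroups Q = parabolic Q ` Pow (cluster_generators Q)"
    unfolding parabolic_subgroups_def by blast
  have "sublattice (parabolic_subgroups Q) (subgroup_lattice (cluster_group Q))"
    unfolding sublattice_def
  proof (intro conjI ballI)
    show "lattice (subgroup_lattice (cluster_group Q))"
      by (rule lattice_subgroup_lattice[OF group_cluster_group])
    show "parabolic_subgroups Q \<subseteq> carrier (subgroup_lattice (cluster_group Q))"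
      by (auto simp: par subgroup_lattice_def inclusion_order_def subgroup_parabolic)
    show "parabolic_subgroups Q \<noteq> {}" by (auto simp: par)
  next
    fix H K assume "H \<in> parabolic_subgroups Q" "K \<in> parabolic_subgroups Q"
    then obtain I J where IJ: "I \<subseteq> cluster_generators Q" "J \<subseteq> cluster_generators Q"
      and HK: "H = parabolic Q I" "K = parabolic Q J" by (auto simp: par)
    note join = subgroup_lattice_join[OF group_cluster_group subgroup_parabolic[OF IJ(1)]
        subgroup_parabolic[OF IJ(2)]]
    note meet = subgroup_lattice_meet[OF group_cluster_group subgroup_parabolic[OF IJ(1)]
        subgroup_parabolic[OF IJ(2)]]
    show "H \<squnion>\<^bsub>subgroup_lattice (cluster_group Q)\<^esub> K \<in> parabolic_subgroups Q"
      unfolding HK join generate_parabolic_Un[OF IJ] using IJ by (auto simp: par)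
    show "H \<sqinter>\<^bsub>subgroup_lattice (cluster_group Q)\<^esub> K \<in> parabolic_subgroups Q"
      unfolding HK meet parabolic_Int[OF IJ] using IJ by (auto simp: par)
  qed
  moreover have "lattice_isomorphism (inclusion_order (Pow (cluster_generators Q)))
      (inclusion_order (parabolic_subgroups Q)) (parabolic Q)"
    unfolding par by (rule lattice_isomorphism_Pow) (rule parabolic_subset_iff)
  ultimately show ?thesis by simp
qed

end
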